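(* Assume that $\mathcal{H}_0$ and $\mathcal{H}_+$ are two Hilbert spaces such that $\mathcal{H}_+$ is closely embedded in $\mathcal{H}_0$, with $j_+$ denoting this closed embedding, and such that $\operatorname{Ran}(j_+)$ is dense in $\mathcal{H}_0$. (1) One can always extend this closed embedding to the triplet $(\mathcal{H}_+;\mathcal{H}_0;\mathcal{R}((j_+^{-1})^* ))$ of closely embedded Hilbert spaces. (2) Let $(\mathcal{H}_+;\mathcal{H}_0;\mathcal{H}_-)$ be any other extension of the closed embedding $j_+$ to a triplet of closely embedded Hilbert spaces, let $A=j_+j_+^*$ be its kernel operator, and let $j_-$ denote the closed embedding of $\mathcal{H}_0$ in $\mathcal{H}_-$. Then there exists a unique unitary operator $\Phi_-\colon\mathcal{H}_-\to\mathcal{R}((j_+^{-1})^* )$ that, when restricted to $\operatorname{Dom}(j_-)$, acts as the identity operator.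
   Context: All Hilbert spaces are complex, with inner products linear in the first variable; operators may be unbounded. For an injective operator $S$, $S^{-1}$ is its algebraic inverse, with $\operatorname{Dom}(S^{-1})=\operatorname{Ran}(S)$. A Hilbert space $\mathcal{K}$ is closely embedded in a Hilbert space $\mathcal{H}$ if there is a linear manifold $\mathcal{D}\subseteq\mathcal{K}\cap\mathcal{H}$ (on which the algebraic structures of $\mathcal{K}$ and $\mathcal{H}$ agree), dense in $\mathcal{K}$, such that the embedding operator $j$ with $\operatorname{Dom}(j)=\mathcal{D}$, $jx=x$, is closed as an operator from $\mathcal{K}$ to $\mathcal{H}$; $j$ is called the closed embedding. $(\mathcal{H}_+;\mathcal{H}_0;\mathcal{H}_-)$ is a triplet of closely embedded Hilbert spaces if: (th1) $\mathcal{H}_+$ is closely embedded in $\mathcal{H}_0$, with closed embedding $j_+$, and $\operatorname{Ran}(j_+)$ is dense in $\mathcal{H}_0$; (th2) $\mathcal{H}_0$ is closely embedded in $\mathcal{H}_-$, with closed embedding $j_-$, and $\operatorname{Ran}(j_-)$ is dense in $\mathcal{H}_-$; (th3) $\operatorname{Dom}(j_+^* )\subseteq\operatorname{Dom}(j_-)$ and for every $y\in\operatorname{Dom}(j_-)\subseteq\mathcal{H}_0$, $$\|y\|_-=\sup\Bigl\{\frac{|\langle x,y\rangle_{\mathcal{H}_0}|}{\|x\|_+}\;\Big|\; x\in\operatorname{Dom}(j_+),\ x\ne0\Bigr\}.$$ Extending the closed embedding $j_+$ to a triplet means finding a triplet whose left-hand closed embedding is the given $j_+$. Vectors of $\operatorname{Dom}(j_-)$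 are identified with their images in $\mathcal{H}_-$. The space $\mathcal{R}(S)$: for a closed, densely defined operator $S$ from a Hilbert space $\mathcal{G}$ to a Hilbert space $\mathcal{H}$, $\mathcal{R}(S)$ is the Hilbert space completion of $\operatorname{Ran}(S)$ with respect to the inner product $\langle Sx,Sy\rangle_S=\langle x,y\rangle_{\mathcal{G}}$ for $x,y\in\operatorname{Dom}(S)$ with $x,y\perp\operatorname{Null}(S)$. The operator $j_S$ has domain $\operatorname{Ran}(S)\subseteq\mathcal{R}(S)$, takes values in $\mathcal{H}$, and is given by $j_Su=u$. Here $S=(j_+^{-1})^*$, the adjoint of the operator $j_+^{-1}$ from $\mathcal{H}_0$ to $\mathcal{H}_+$, so $S$ acts from $\mathcal{H}_+$ to $\mathcal{H}_0$; the closed embedding of $\mathcal{H}_0$ in $\mathcal{R}(S)$ is $j_S^{-1}$, with domain $\operatorname{Ran}(S)\subseteq\mathcal{H}_0$. *)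

theory Defs
  imports "HOL-Analysis.Analysis" "HOL-Algebra.Module" "HOL-Decision_Procs.Algebra_Aux"
begin

text \<open>
  The space \<open>\<R>(S)\<close> depends on an operator, so it cannot be a type; Hilbert spaces are
  therefore records.  The scalars are the complex numbers, \<open>cring_class_ops :: complex ring\<close>.
  A module record inherits from rings the fields \<open>mult\<close> and \<open>one\<close>, which the locale
  \<open>module\<close> never constrains on the module side; they carry no meaning here.
\<close>

record 'a inner_space = "(complex, 'a) module" +
  cinner :: "'a \<Rightarrow> 'a \<Rightarrow> complex" (\<open>\<langle>_, _\<rangle>\<index>\<close>)

definition hnorm :: "'a inner_space \<Rightarrow> 'a \<Rightarrow> real" where
  "hnorm H x = sqrt (Re (\<langle>x, x\<rangle>\<^bsub>H\<^esub>))"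

text \<open>The value outside the carrier only serves the library's locale \<open>Metric_space\<close>, which asks
  for a distance that is nonnegative and symmetric on the whole type.\<close>

definition hdist :: "'a inner_space \<Rightarrow> 'a \<Rightarrow> 'a \<Rightarrow> real" where
  "hdist H x y = (if x \<in> carrier H \<and> y \<in> carrier H then hnorm H (x \<ominus>\<^bsub>H\<^esub> y) else 0)"

definition htop :: "'a inner_space \<Rightarrow> 'a topology" where
  "htop H = Metric_space.mtopology (carrier H) (hdist H)"

locale complex_inner_space = Module.module "cring_class_ops :: complex ring" H
  for H :: "'a inner_space" (structure) +
  assumes cinner_add_left: "\<lbrakk>x \<in> carrier H; y \<in> carrier H; z \<in> carrier H\<rbrakk>
      \<Longrightarrow> \<langle>x \<oplus> y, z\<rangle> = \<langle>x, z\<rangle> + \<langle>y, z\<rangle>"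
    and cinner_smult_left: "\<lbrakk>x \<in> carrier H; y \<in> carrier H\<rbrakk> \<Longrightarrow> \<langle>c \<odot> x, y\<rangle> = c * \<langle>x, y\<rangle>"
    and cinner_commute: "\<lbrakk>x \<in> carrier H; y \<in> carrier H\<rbrakk> \<Longrightarrow> \<langle>x, y\<rangle> = cnj \<langle>y, x\<rangle>"
    and cinner_nonneg: "x \<in> carrier H \<Longrightarrow> 0 \<le> Re \<langle>x, x\<rangle>"
    and cinner_definite: "\<lbrakk>x \<in> carrier H; \<langle>x, x\<rangle> = 0\<rbrakk> \<Longrightarrow> x = \<zero>"

locale complex_hilbert_space = complex_inner_space +
  assumes complete: "Metric_space.mcomplete (carrier H) (hdist H)"

definition dense_in :: "'a inner_space \<Rightarrow> 'a set \<Rightarrow> bool" where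
  "dense_in H D \<longleftrightarrow> D \<subseteq> carrier H \<and> htop H closure_of D = carrier H"

text \<open>
  An operator is identified with its graph.  Its domain, range and algebraic inverse are
  \<^const>\<open>Domain\<close>, \<^const>\<open>Range\<close> and \<^const>\<open>converse\<close>; the composition
  \<open>T U\<close> (first \<open>U\<close>, then \<open>T\<close>) is \<open>U O T\<close>.
\<close>

definition linear_operator :: "'a inner_space \<Rightarrow> 'b inner_space \<Rightarrow> ('a \<times> 'b) set \<Rightarrow> bool" where
  "linear_operator K H T \<longleftrightarrow>
     T \<subseteq> carrier K \<times> carrier H \<and> single_valued T \<and>
     (\<zero>\<^bsub>K\<^esub>, \<zero>\<^bsub>H\<^esub>) \<in> T \<and>
     (\<forall>(x, y) \<in> T. \<forall>(x', y') \<in> T. (x \<oplus>\<^bsub>K\<^esub> x', y \<oplus>\<^bsub>H\<^esub> y') \<in> T) \<and>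
     (\<forall>(x, y) \<in> T. \<forall>c. (c \<odot>\<^bsub>K\<^esub> x, c \<odot>\<^bsub>H\<^esub> y) \<in> T)"

definition closed_operator :: "'a inner_space \<Rightarrow> 'b inner_space \<Rightarrow> ('a \<times> 'b) set \<Rightarrow> bool" where
  "closed_operator K H T \<longleftrightarrow>
     linear_operator K H T \<and> closedin (prod_topology (htop K) (htop H)) T"

definition null_space :: "'a inner_space \<Rightarrow> 'b inner_space \<Rightarrow> ('a \<times> 'b) set \<Rightarrow> 'a set" where
  "null_space K H T = {x. (x, \<zero>\<^bsub>H\<^esub>) \<in> T}"

definition op_adjoint :: "'a inner_space \<Rightarrow> 'b inner_space \<Rightarrow> ('a \<times> 'b) set \<Rightarrow> ('b \<times> 'a) set" where
  "op_adjoint K H T = {(y, z). y \<in> carrier H \<and> z \<in> carrier K \<and>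
     (\<forall>(x, w) \<in> T. \<langle>w, y\<rangle>\<^bsub>H\<^esub> = \<langle>x, z\<rangle>\<^bsub>K\<^esub>)}"

definition unitary_operator :: "'a inner_space \<Rightarrow> 'b inner_space \<Rightarrow> ('a \<times> 'b) set \<Rightarrow> bool" where
  "unitary_operator K H U \<longleftrightarrow>
     linear_operator K H U \<and> Domain U = carrier K \<and> Range U = carrier H \<and>
     (\<forall>(x, y) \<in> U. \<forall>(x', y') \<in> U. \<langle>y, y'\<rangle>\<^bsub>H\<^esub> = \<langle>x, x'\<rangle>\<^bsub>K\<^esub>)"

text \<open>
  Vectors of \<open>\<K>\<close> and \<open>\<H>\<close> may have different types, so the manifold \<open>\<D> \<subseteq> \<K> \<inter> \<H>\<close> is
  given by the identification \<open>j\<close> itself: \<open>(x, y) \<in> j\<close> says that \<open>x \<in> \<K>\<close> and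
  \<open>y \<in> \<H>\<close> are the same vector of \<open>\<D>\<close>.  That each vector of \<open>\<D>\<close> occurs exactly once on
  either side is single-valuedness in both directions, and that the algebraic structures
  agree on \<open>\<D>\<close> is linearity.  If the two types coincide and \<open>\<D>\<close> is literally a subset
  of both spaces, then \<open>j = Id_on \<D>\<close>.
\<close>

definition closed_embedding :: "'a inner_space \<Rightarrow> 'b inner_space \<Rightarrow> ('a \<times> 'b) set \<Rightarrow> bool" where
  "closed_embedding K H j \<longleftrightarrow>
     closed_operator K H j \<and> single_valued (j\<inverse>) \<and> dense_in K (Domain j)"

text \<open>
  The supremum in the third condition is taken in \<^typ>\<open>ennreal\<close>: the equation then includes
  its finiteness, and for \<open>\<H>\<^sub>+ = {0}\<close> the empty supremum is \<open>0\<close>.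
\<close>

definition triplet ::
  "'p inner_space \<Rightarrow> 'z inner_space \<Rightarrow> 'm inner_space \<Rightarrow> ('p \<times> 'z) set \<Rightarrow> ('z \<times> 'm) set \<Rightarrow> bool"
where
  "triplet Hp H0 Hm jp jm \<longleftrightarrow>
     complex_hilbert_space Hp \<and> complex_hilbert_space H0 \<and> complex_hilbert_space Hm \<and>
     closed_embedding Hp H0 jp \<and> dense_in H0 (Range jp) \<and>
     closed_embedding H0 Hm jm \<and> dense_in Hm (Range jm) \<and>
     Domain (op_adjoint Hp H0 jp) \<subseteq> Domain jm \<and>
     (\<forall>(y, v) \<in> jm. ennreal (hnorm Hm v) =
        (SUP (x, w) \<in> {(x, w) \<in> jp. x \<noteq> \<zero>\<^bsub>Hp\<^esub>}. ennreal (cmod (\<langle>w, y\<rangle>\<^bsub>H0\<^esub>) / hnorm Hp x)))"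

definition kernel_operator ::
  "'p inner_space \<Rightarrow> 'z inner_space \<Rightarrow> ('p \<times> 'z) set \<Rightarrow> ('z \<times> 'z) set" where
  "kernel_operator Hp H0 jp = op_adjoint Hp H0 jp O jp"

text \<open>Equivalence classes of Cauchy sequences, two sequences being equivalent if their distance
  tends to zero.  A vector is identified with the class of the corresponding constant sequence.\<close>

definition cauchy_seqs :: "'a inner_space \<Rightarrow> (nat \<Rightarrow> 'a) set" where
  "cauchy_seqs V = {s. Metric_space.MCauchy (carrier V) (hdist V) s}"

definition cauchy_rel :: "'a inner_space \<Rightarrow> ((nat \<Rightarrow> 'a) \<times> (nat \<Rightarrow> 'a)) set" where
  "cauchy_rel V = {(s, t). s \<in> cauchy_seqs V \<and> t \<in> cauchy_seqs V \<and>
     (\<lambda>n. hdist V (s n) (t n)) \<longlonglongrightarrow> 0}"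

definition cauchy_class :: "'a inner_space \<Rightarrow> (nat \<Rightarrow> 'a) \<Rightarrow> (nat \<Rightarrow> 'a) set" where
  "cauchy_class V s = cauchy_rel V `` {s}"

definition cauchy_rep :: "(nat \<Rightarrow> 'a) set \<Rightarrow> nat \<Rightarrow> 'a" where
  "cauchy_rep X = (SOME s. s \<in> X)"

definition completion :: "'a inner_space \<Rightarrow> (nat \<Rightarrow> 'a) set inner_space" where
  "completion V =
     \<lparr>carrier = cauchy_seqs V // cauchy_rel V,
      mult = (\<lambda>_ _. undefined),
      one = undefined,
      zero = cauchy_class V (\<lambda>_. \<zero>\<^bsub>V\<^esub>),
      add = (\<lambda>X Y. cauchy_class V (\<lambda>n. cauchy_rep X n \<oplus>\<^bsub>V\<^esub> cauchy_rep Y n)),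
      smult = (\<lambda>c X. cauchy_class V (\<lambda>n. c \<odot>\<^bsub>V\<^esub> cauchy_rep X n)),
      cinner = (\<lambda>X Y. lim (\<lambda>n. \<langle>cauchy_rep X n, cauchy_rep Y n\<rangle>\<^bsub>V\<^esub>))\<rparr>"

text \<open>\<open>S\<close> is an operator from \<open>G\<close> to \<open>H\<close>; each \<open>u \<in> Ran S\<close> is \<open>S x\<close> for exactly one
  \<open>x \<in> Dom S\<close> orthogonal to the null space of \<open>S\<close>.\<close>

definition reduced_preimage :: "'a inner_space \<Rightarrow> 'b inner_space \<Rightarrow> ('a \<times> 'b) set \<Rightarrow> 'b \<Rightarrow> 'a" where
  "reduced_preimage G H S u =
     (THE x. (x, u) \<in> S \<and> (\<forall>z \<in> null_space G H S. \<langle>x, z\<rangle>\<^bsub>G\<^esub> = 0))"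

definition pre_R_space :: "'a inner_space \<Rightarrow> 'b inner_space \<Rightarrow> ('a \<times> 'b) set \<Rightarrow> 'b inner_space" where
  "pre_R_space G H S = H\<lparr>carrier := Range S,
     cinner := (\<lambda>u v. \<langle>reduced_preimage G H S u, reduced_preimage G H S v\<rangle>\<^bsub>G\<^esub>)\<rparr>"

definition R_space ::
  "'a inner_space \<Rightarrow> 'b inner_space \<Rightarrow> ('a \<times> 'b) set \<Rightarrow> (nat \<Rightarrow> 'b) set inner_space" where
  "R_space G H S = completion (pre_R_space G H S)"

definition R_operator ::
  "'a inner_space \<Rightarrow> 'b inner_space \<Rightarrow> ('a \<times> 'b) set \<Rightarrow> ((nat \<Rightarrow> 'b) set \<times> 'b) set" where
  "R_operator G H S = {(cauchy_class (pre_R_space G H S) (\<lambda>_. u), u) | u. u \<in> Range S}"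

end

theory Submission
  imports Defs
begin

text \<open>
  Since \<open>Dom j\<^sub>+\<close> and \<open>Ran j\<^sub>+\<close> are dense, \<open>S = (j\<^sub>+\<^sup>-\<^sup>1)\<^sup>* = (j\<^sub>+\<^sup>*)\<^sup>-\<^sup>1\<close> is a closed
  injective operator, and because \<open>j\<^sub>+\<close> is closed and injective its domain and range are dense.
  Hence \<open>S z \<mapsto> z\<close> is an isometry of \<open>Ran S\<close>, with the norm of \<open>\<R>(S)\<close>, onto a dense
  subspace of \<open>\<H>\<^sub>+\<close>, and identifies the completion \<open>\<R>(S)\<close> with \<open>\<H>\<^sub>+\<close>; the norm of
  \<open>S z\<close> is \<open>\<parallel>z\<parallel>\<^sub>+\<close>, which is the supremum in (th3) by density of \<open>Dom j\<^sub>+\<close>.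
  In any other triplet, (th3) and the Riesz representation force \<open>Dom j\<^sub>- = Ran S\<close> with the
  same norm, so the identity on \<open>Ran S\<close> is an isometry between dense subspaces of \<open>\<H>\<^sub>-\<close> and
  \<open>\<R>(S)\<close>, which extends uniquely to a unitary operator.
\<close>

section \<open>Inner product spaces\<close>

text \<open>The density statements rest on one fact about the product of \<open>Hp\<close> and
  \<open>H0\<close>: a point outside a closed linear manifold is seen by some vector orthogonal to
  that manifold. It is applied to the graph of \<open>jp\<close>, with the test points
  \<open>(0, u)\<close> and \<open>(u, 0)\<close>. Riesz is proved on a linear manifold that may
  fail to be closed, since the functional in (th3) lives only on the dense set
  \<open>Domain jp\<close>; the representing vector is a limit of vectors of the manifold. Vectors
  of \<R>(S) are classes of Cauchy sequences, with operations defined through chosen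
  representatives. Each class is rewritten as the set of all sequences whose preimages under S
  converge to a fixed h in \<open>Hp\<close>. In this form the choice of representative is harmless,
  and the Hilbert space laws are pulled back along class \<mapsto> h instead of being checked on
  classes. The other space \<H>_- and \<R>(S) have different types, so acting as the identity means
  containing the graph of pairs \<open>(v, r)\<close> that are images of the same \<open>y\<close>;
  the unitary operator is the closure of this graph.\<close>

context complex_inner_space
begin

lemma smult_mem [simp, intro]: "x \<in> carrier H \<Longrightarrow> c \<odot> x \<in> carrier H"
  by (simp add: carrier_class)

lemma cinner_add_right:
  assumes "x \<in> carrier H" "y \<in> carrier H" "z \<in> carrier H"
  shows "\<langle>x, y \<oplus> z\<rangle> = \<langle>x, y\<rangle> + \<langle>x, z\<rangle>"
  using assms by (metis M.add.m_closed cinner_add_left cinner_commute complex_cnj_add)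

lemma cinner_smult_right:
  assumes "x \<in> carrier H" "y \<in> carrier H"
  shows "\<langle>x, c \<odot> y\<rangle> = cnj c * \<langle>x, y\<rangle>"
  using assms by (metis smult_mem cinner_smult_left cinner_commute complex_cnj_mult)

lemma uminus_eq_smult: "x \<in> carrier H \<Longrightarrow> \<ominus> x = (-1) \<odot> x"
  using smult_l_minus[of 1 x] smult_one[of x] by (simp add: class_simps)

lemma minus_eq_smult: "x \<in> carrier H \<Longrightarrow> y \<in> carrier H \<Longrightarrow> x \<ominus> y = x \<oplus> (-1) \<odot> y"
  by (simp add: a_minus_def uminus_eq_smult)

lemma cinner_diff_left:
  "\<lbrakk>x \<in> carrier H; y \<in> carrier H; z \<in> carrier H\<rbrakk> \<Longrightarrow> \<langle>x \<ominus> y, z\<rangle> = \<langle>x, z\<rangle> - \<langle>y, z\<rangle>"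
  by (simp add: minus_eq_smult cinner_add_left cinner_smult_left)

lemma cinner_diff_right:
  "\<lbrakk>x \<in> carrier H; y \<in> carrier H; z \<in> carrier H\<rbrakk> \<Longrightarrow> \<langle>x, y \<ominus> z\<rangle> = \<langle>x, y\<rangle> - \<langle>x, z\<rangle>"
  by (simp add: minus_eq_smult cinner_add_right cinner_smult_right)

lemma cinner_zero_left [simp]: "x \<in> carrier H \<Longrightarrow> \<langle>\<zero>, x\<rangle> = 0"
  using cinner_add_left[of \<zero> \<zero> x] by simp

lemma cinner_zero_right [simp]: "x \<in> carrier H \<Longrightarrow> \<langle>x, \<zero>\<rangle> = 0"
  using cinner_add_right[of x \<zero> \<zero>] by simp

lemmas cinner_linear = cinner_add_left cinner_add_right cinner_smult_left cinner_smult_right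
  cinner_diff_left cinner_diff_right

lemma Re_cinner_commute: "\<lbrakk>x \<in> carrier H; y \<in> carrier H\<rbrakk> \<Longrightarrow> Re \<langle>y, x\<rangle> = Re \<langle>x, y\<rangle>"
  by (subst cinner_commute) auto

lemma hnorm_nonneg [simp]: "x \<in> carrier H \<Longrightarrow> 0 \<le> hnorm H x"
  by (simp add: hnorm_def cinner_nonneg)

lemma hnorm_power2: "x \<in> carrier H \<Longrightarrow> (hnorm H x)\<^sup>2 = Re \<langle>x, x\<rangle>"
  by (simp add: hnorm_def cinner_nonneg)

lemma cinner_self: "x \<in> carrier H \<Longrightarrow> \<langle>x, x\<rangle> = complex_of_real ((hnorm H x)\<^sup>2)"
  using cinner_commute[of x x] by (simp add: hnorm_power2 complex_eq_iff)

lemma hnorm_eq_0_iff: "x \<in> carrier H \<Longrightarrow> hnorm H x = 0 \<longleftrightarrow> x = \<zero>"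
  using cinner_definite[of x] cinner_self[of x] by auto

lemma hnorm_zero [simp]: "hnorm H \<zero> = 0"
  by (simp add: hnorm_eq_0_iff)

lemma hnorm_smult:
  assumes x: "x \<in> carrier H"
  shows "hnorm H (c \<odot> x) = cmod c * hnorm H x"
proof (rule power2_eq_imp_eq)
  have "\<langle>c \<odot> x, c \<odot> x\<rangle> = complex_of_real ((cmod c)\<^sup>2 * (hnorm H x)\<^sup>2)"
    using x by (simp only: cinner_linear smult_mem cinner_self[OF x] complex_norm_square
        of_real_mult mult_ac)
  then show "(hnorm H (c \<odot> x))\<^sup>2 = (cmod c * hnorm H x)\<^sup>2"
    using x by (simp add: hnorm_power2[of "c \<odot> x"] power_mult_distrib del: of_real_power)
qed (use x in auto)

lemma hnorm_add_power2: "\<lbrakk>x \<in> carrier H; y \<in> carrier H\<rbrakk> \<Longrightarrow>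
    (hnorm H (x \<oplus> y))\<^sup>2 = (hnorm H x)\<^sup>2 + 2 * Re \<langle>x, y\<rangle> + (hnorm H y)\<^sup>2"
  by (simp add: hnorm_power2 cinner_linear Re_cinner_commute)

lemma hnorm_diff_power2: "\<lbrakk>x \<in> carrier H; y \<in> carrier H\<rbrakk> \<Longrightarrow>
    (hnorm H (x \<ominus> y))\<^sup>2 = (hnorm H x)\<^sup>2 - 2 * Re \<langle>x, y\<rangle> + (hnorm H y)\<^sup>2"
  by (simp add: hnorm_power2 cinner_linear Re_cinner_commute)

lemma Cauchy_Schwarz:
  assumes x: "x \<in> carrier H" and y: "y \<in> carrier H"
  shows "cmod \<langle>x, y\<rangle> \<le> hnorm H x * hnorm H y"
proof (cases "y = \<zero>")
  case False
  then have pos: "0 < (hnorm H y)\<^sup>2"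
    using y by (simp add: hnorm_eq_0_iff)
  define a where "a = complex_of_real ((hnorm H y)\<^sup>2)"
  \<comment> \<open>This is the component of \<open>x\<close> orthogonal to \<open>y\<close>,
    multiplied by \<parallel>y\<parallel>^2 to avoid a division; the inequality is the nonnegativity
    of its square norm.\<close>
  define z where "z = a \<odot> x \<ominus> \<langle>x, y\<rangle> \<odot> y"
  have yy: "\<langle>y, y\<rangle> = a" "cnj a = a"
    using y by (simp_all add: cinner_self a_def)
  have "\<langle>z, z\<rangle> = a * (a * \<langle>x, x\<rangle> - \<langle>x, y\<rangle> * cnj \<langle>x, y\<rangle>)"
    using x y cinner_commute[OF y x]
    by (simp add: z_def cinner_linear yy algebra_simps)
  also have "\<dots> = complex_of_real ((hnorm H y)\<^sup>2 *
      ((hnorm H y)\<^sup>2 * (hnorm H x)\<^sup>2 - (cmod \<langle>x, y\<rangle>)\<^sup>2))"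
    using x by (simp add: a_def cinner_self complex_norm_square del: of_real_power)
  finally have "0 \<le> (hnorm H y)\<^sup>2 * ((hnorm H y)\<^sup>2 * (hnorm H x)\<^sup>2 - (cmod \<langle>x, y\<rangle>)\<^sup>2)"
    using cinner_nonneg[of z] x y by (simp add: z_def)
  then have "0 \<le> (hnorm H y)\<^sup>2 * (hnorm H x)\<^sup>2 - (cmod \<langle>x, y\<rangle>)\<^sup>2"
    using mult_le_cancel_left_pos[OF pos, of 0] by (simp only: mult_zero_right)
  then have "(cmod \<langle>x, y\<rangle>)\<^sup>2 \<le> (hnorm H x * hnorm H y)\<^sup>2"
    by (metis diff_ge_0_iff_ge mult.commute power_mult_distrib)
  then show ?thesis
    by (rule power2_le_imp_le) (use x y in simp)
qed (use x in auto)

lemma hnorm_triangle: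
  assumes x: "x \<in> carrier H" and y: "y \<in> carrier H"
  shows "hnorm H (x \<oplus> y) \<le> hnorm H x + hnorm H y"
proof (rule power2_le_imp_le)
  have "Re \<langle>x, y\<rangle> \<le> hnorm H x * hnorm H y"
    using Cauchy_Schwarz[OF x y] complex_Re_le_cmod order_trans by blast
  then show "(hnorm H (x \<oplus> y))\<^sup>2 \<le> (hnorm H x + hnorm H y)\<^sup>2"
    using x y by (simp add: hnorm_add_power2 power2_sum)
qed (use x y in auto)

lemma diff_eq_zero_iff: "\<lbrakk>x \<in> carrier H; y \<in> carrier H\<rbrakk> \<Longrightarrow> x \<ominus> y = \<zero> \<longleftrightarrow> x = y"
  by (metis M.add.inv_equality M.add.inv_inv M.add.inv_closed M.add.r_inv M.minus_eq)

lemma diff_self [simp]: "x \<in> carrier H \<Longrightarrow> x \<ominus> x = \<zero>"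
  by (simp add: diff_eq_zero_iff)

lemma diff_zero [simp]: "x \<in> carrier H \<Longrightarrow> x \<ominus> \<zero> = x"
  by (simp add: minus_eq_smult carrier_class)

lemma hnorm_diff_commute:
  assumes "x \<in> carrier H" "y \<in> carrier H"
  shows "hnorm H (x \<ominus> y) = hnorm H (y \<ominus> x)"
  by (rule power2_eq_imp_eq) (use assms in \<open>simp_all add: hnorm_diff_power2 Re_cinner_commute\<close>)

lemma hnorm_diff_triangle:
  assumes "x \<in> carrier H" "y \<in> carrier H" "z \<in> carrier H"
  shows "hnorm H (x \<ominus> z) \<le> hnorm H (x \<ominus> y) + hnorm H (y \<ominus> z)"
proof -
  have "x \<ominus> z = (x \<ominus> y) \<oplus> (y \<ominus> z)"
    using assms by (simp add: a_minus_def M.a_assoc M.r_neg1)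
  then show ?thesis
    using assms hnorm_triangle[of "x \<ominus> y" "y \<ominus> z"] by simp
qed

lemma hdist_eq: "\<lbrakk>x \<in> carrier H; y \<in> carrier H\<rbrakk> \<Longrightarrow> hdist H x y = hnorm H (x \<ominus> y)"
  by (simp add: hdist_def)

sublocale Metric_space "carrier H" "hdist H"
proof
  show "0 \<le> hdist H x y" for x y
    by (simp add: hdist_def)
  show "hdist H x y = hdist H y x" for x y
    by (auto simp: hdist_def hnorm_diff_commute)
  show "hdist H x y = 0 \<longleftrightarrow> x = y" if "x \<in> carrier H" "y \<in> carrier H" for x y
    using that by (simp add: hdist_eq hnorm_eq_0_iff diff_eq_zero_iff)
  show "hdist H x z \<le> hdist H x y + hdist H y z"
    if "x \<in> carrier H" "y \<in> carrier H" "z \<in> carrier H" for x y z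
    using that by (simp add: hdist_eq hnorm_diff_triangle)
qed

end

section \<open>Convergence, density and the Riesz representation\<close>

text \<open>Convergence as a null sequence of real norms, so that limits reduce to real analysis;
  \<open>limitin_iff_hconv\<close> ties it to the topology behind density and closedness.\<close>

definition hconv :: "'a inner_space \<Rightarrow> (nat \<Rightarrow> 'a) \<Rightarrow> 'a \<Rightarrow> bool" where
  "hconv H s l \<longleftrightarrow> range s \<subseteq> carrier H \<and> l \<in> carrier H \<and>
     (\<lambda>n. hnorm H (s n \<ominus>\<^bsub>H\<^esub> l)) \<longlonglongrightarrow> 0"

definition linear_manifold :: "'a inner_space \<Rightarrow> 'a set \<Rightarrow> bool" where
  "linear_manifold H D \<longleftrightarrow> D \<subseteq> carrier H \<and> \<zero>\<^bsub>H\<^esub> \<in> D \<and>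
     (\<forall>x\<in>D. \<forall>y\<in>D. x \<oplus>\<^bsub>H\<^esub> y \<in> D) \<and> (\<forall>x\<in>D. \<forall>c. c \<odot>\<^bsub>H\<^esub> x \<in> D)"

text \<open>First-order condition at a minimum: a parabola through the origin that never becomes
  negative has slope 0 there.\<close>

lemma linear_coefficient_eq_0:
  fixes a b :: real
  assumes "\<And>t. 0 \<le> 2 * t * a + t\<^sup>2 * b" and b: "0 \<le> b"
  shows "a = 0"
proof -
  \<comment> \<open>The vertex lies at -a/b; the denominator b + 1 stays positive for b = 0 and
    still yields a negative value unless a = 0.\<close>
  define q where "q = a / (b + 1)"
  have a: "a = q * (b + 1)"
    using b by (simp add: q_def)
  have "2 * (- q) * a + (- q)\<^sup>2 * b = - (q\<^sup>2 * (b + 2))"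
    by (simp add: a power2_eq_square algebra_simps)
  then have "q\<^sup>2 * (b + 2) \<le> 0"
    using assms(1)[of "- q"] by linarith
  then have "q = 0"
    using b by (simp add: mult_le_0_iff)
  then show ?thesis
    by (simp add: a)
qed

lemma hconv_carrier:
  "hconv H s l \<Longrightarrow> s n \<in> carrier H" "hconv H s l \<Longrightarrow> l \<in> carrier H"
  by (auto simp: hconv_def)

context complex_inner_space
begin

lemma hconvI:
  assumes "\<And>n. s n \<in> carrier H" "l \<in> carrier H"
    and "\<And>n. hnorm H (s n \<ominus> l) \<le> g n" "g \<longlonglongrightarrow> 0"
  shows "hconv H s l"
  unfolding hconv_def
proof (intro conjI)
  show "(\<lambda>n. hnorm H (s n \<ominus> l)) \<longlonglongrightarrow> 0"
    by (rule tendsto_sandwich[OF _ _ tendsto_const assms(4)]) (use assms in auto)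
qed (use assms in auto)

lemma hconv_const: "l \<in> carrier H \<Longrightarrow> hconv H (\<lambda>_. l) l"
  by (rule hconvI[where g = "\<lambda>_. 0"]) simp_all

lemma hconv_add:
  assumes s: "hconv H s l" and t: "hconv H t m"
  shows "hconv H (\<lambda>n. s n \<oplus> t n) (l \<oplus> m)"
proof (rule hconvI)
  note c = hconv_carrier[OF s] hconv_carrier[OF t]
  show "hnorm H ((s n \<oplus> t n) \<ominus> (l \<oplus> m)) \<le> hnorm H (s n \<ominus> l) + hnorm H (t n \<ominus> m)" for n
  proof -
    have "(s n \<oplus> t n) \<ominus> (l \<oplus> m) = (s n \<ominus> l) \<oplus> (t n \<ominus> m)"
      using c by (simp add: minus_eq_smult smult_r_distr carrier_class M.a_ac)
    then show ?thesis
      using c by (simp add: hnorm_triangle)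
  qed
  show "(\<lambda>n. hnorm H (s n \<ominus> l) + hnorm H (t n \<ominus> m)) \<longlonglongrightarrow> 0"
    using s t by (auto simp: hconv_def intro: tendsto_add_zero)
qed (use hconv_carrier[OF s] hconv_carrier[OF t] in auto)

lemma smult_commute: "x \<in> carrier H \<Longrightarrow> a \<odot> (b \<odot> x) = b \<odot> (a \<odot> x)"
  using smult_assoc1[of a b x] smult_assoc1[of b a x] by (simp add: class_simps mult.commute)

lemma hconv_smult:
  assumes s: "hconv H s l"
  shows "hconv H (\<lambda>n. c \<odot> s n) (c \<odot> l)"
proof (rule hconvI)
  show "hnorm H (c \<odot> s n \<ominus> c \<odot> l) \<le> cmod c * hnorm H (s n \<ominus> l)" for n
  proof -
    have "c \<odot> s n \<ominus> c \<odot> l = c \<odot> (s n \<ominus> l)"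
      using hconv_carrier[OF s]
      by (simp add: minus_eq_smult smult_r_distr carrier_class smult_commute)
    then show ?thesis
      using hconv_carrier[OF s] by (simp add: hnorm_smult)
  qed
  show "(\<lambda>n. cmod c * hnorm H (s n \<ominus> l)) \<longlonglongrightarrow> 0"
    using s by (auto simp: hconv_def intro: tendsto_mult_right_zero)
qed (use hconv_carrier[OF s] in auto)

lemma hconv_diff:
  assumes "hconv H s l" "hconv H t m"
  shows "hconv H (\<lambda>n. s n \<ominus> t n) (l \<ominus> m)"
  using hconv_add[OF assms(1) hconv_smult[OF assms(2), of "-1"]] hconv_carrier[OF assms(1)]
    hconv_carrier[OF assms(2)] by (simp add: minus_eq_smult)

lemma hconv_hnorm:
  assumes s: "hconv H s l"
  shows "(\<lambda>n. hnorm H (s n)) \<longlonglongrightarrow> hnorm H l"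
proof (rule LIM_zero_cancel, rule Lim_null_comparison[OF always_eventually])
  note c = hconv_carrier[OF s]
  show "\<forall>n. norm (hnorm H (s n) - hnorm H l) \<le> hnorm H (s n \<ominus> l)"
  proof
    fix n
    show "norm (hnorm H (s n) - hnorm H l) \<le> hnorm H (s n \<ominus> l)"
      using hnorm_diff_triangle[OF c(1)[of n] c(2) M.zero_closed]
        hnorm_diff_triangle[OF c(2) c(1)[of n] M.zero_closed] hnorm_diff_commute[OF c(1)[of n] c(2)]
      by (simp add: c)
  qed
  show "(\<lambda>n. hnorm H (s n \<ominus> l)) \<longlonglongrightarrow> 0"
    using s by (simp add: hconv_def)
qed

lemma hconv_cinner:
  assumes s: "hconv H s l" and t: "hconv H t m"
  shows "(\<lambda>n. \<langle>s n, t n\<rangle>) \<longlonglongrightarrow> \<langle>l, m\<rangle>"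
proof (rule LIM_zero_cancel, rule Lim_null_comparison[OF always_eventually])
  note c = hconv_carrier[OF s] hconv_carrier[OF t]
  show "\<forall>n. norm (\<langle>s n, t n\<rangle> - \<langle>l, m\<rangle>) \<le>
      hnorm H (s n \<ominus> l) * hnorm H (t n) + hnorm H l * hnorm H (t n \<ominus> m)"
  proof
    fix n
    have "\<langle>s n, t n\<rangle> - \<langle>l, m\<rangle> = \<langle>s n \<ominus> l, t n\<rangle> + \<langle>l, t n \<ominus> m\<rangle>"
      using c by (simp add: cinner_linear)
    also have "norm \<dots> \<le> hnorm H (s n \<ominus> l) * hnorm H (t n) + hnorm H l * hnorm H (t n \<ominus> m)"
      using c by (intro norm_triangle_mono Cauchy_Schwarz) auto
    finally show "norm (\<langle>s n, t n\<rangle> - \<langle>l, m\<rangle>) \<le>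
      hnorm H (s n \<ominus> l) * hnorm H (t n) + hnorm H l * hnorm H (t n \<ominus> m)" .
  qed
  have "(\<lambda>n. hnorm H (s n \<ominus> l) * hnorm H (t n) + hnorm H l * hnorm H (t n \<ominus> m)) \<longlonglongrightarrow>
      0 * hnorm H m + hnorm H l * 0"
    using s t hconv_hnorm[OF t] by (intro tendsto_intros) (auto simp: hconv_def)
  then show "(\<lambda>n. hnorm H (s n \<ominus> l) * hnorm H (t n) + hnorm H l * hnorm H (t n \<ominus> m)) \<longlonglongrightarrow> 0"
    by simp
qed

lemma hconv_unique:
  assumes "hconv H s l" "hconv H s m"
  shows "l = m"
proof -
  have c: "l \<in> carrier H" "m \<in> carrier H" "\<And>n. s n \<in> carrier H"
    using hconv_carrier[OF assms(1)] hconv_carrier[OF assms(2)] by auto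
  have "(\<lambda>n. hnorm H (s n \<ominus> s n)) \<longlonglongrightarrow> hnorm H (l \<ominus> m)"
    by (rule hconv_hnorm) (rule hconv_diff[OF assms])
  then have "hnorm H (l \<ominus> m) = 0"
    using c by (simp add: diff_eq_zero_iff LIMSEQ_const_iff)
  then show ?thesis
    using c by (simp add: hnorm_eq_0_iff diff_eq_zero_iff)
qed

lemma limitin_iff_hconv:
  assumes "range s \<subseteq> carrier H"
  shows "limitin (htop H) s l sequentially \<longleftrightarrow> hconv H s l"
proof -
  have "(\<lambda>n. hdist H (s n) l) = (\<lambda>n. hnorm H (s n \<ominus> l))" if "l \<in> carrier H"
    using assms that by (intro ext hdist_eq) auto
  then show ?thesis
    using assms unfolding htop_def limitin_metric_dist_null hconv_def
    by (auto simp: image_subset_iff)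
qed

lemma hconv_imp_MCauchy: "hconv H s l \<Longrightarrow> MCauchy s"
  using convergent_imp_MCauchy[of s l] limitin_iff_hconv[of s l]
  by (auto simp: hconv_def htop_def)

text \<open>Density is used from here on through approximating sequences; one direction picks a
  point of \<open>D\<close> in each ball of radius 1/(n+1).\<close>

lemma dense_in_iff:
  "dense_in H D \<longleftrightarrow> D \<subseteq> carrier H \<and> (\<forall>x\<in>carrier H. \<exists>s. range s \<subseteq> D \<and> hconv H s x)"
proof -
  have "(\<forall>r>0. \<exists>y\<in>D. y \<in> mball x r) \<longleftrightarrow> (\<exists>s. range s \<subseteq> D \<and> hconv H s x)"
    if D: "D \<subseteq> carrier H" and x: "x \<in> carrier H" for x
  proof
    assume L: "\<forall>r>0. \<exists>y\<in>D. y \<in> mball x r"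
    have "\<exists>y\<in>D. y \<in> mball x (inverse (real (Suc n)))" for n
      using L by (metis inverse_positive_iff_positive of_nat_0_less_iff zero_less_Suc)
    then obtain s where s: "\<And>n. s n \<in> D" "\<And>n. s n \<in> mball x (inverse (real (Suc n)))"
      by metis
    have "hconv H s x"
    proof (rule hconvI)
      show "hnorm H (s n \<ominus> x) \<le> inverse (real (Suc n))" for n
        using s(2)[of n] hnorm_diff_commute[of x "s n"] by (auto simp: hdist_eq)
    qed (use s D x LIMSEQ_inverse_real_of_nat in auto)
    then show "\<exists>s. range s \<subseteq> D \<and> hconv H s x"
      using s(1) by blast
  next
    assume "\<exists>s. range s \<subseteq> D \<and> hconv H s x"
    then obtain s where s: "range s \<subseteq> D" "hconv H s x"
      by blast
    show "\<forall>r>0. \<exists>y\<in>D. y \<in> mball x r"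
    proof (intro allI impI)
      fix r :: real
      assume "0 < r"
      then have "\<forall>\<^sub>F n in sequentially. hnorm H (s n \<ominus> x) < r"
        using s(2) by (auto simp: hconv_def intro: order_tendstoD)
      then obtain n where "hnorm H (s n \<ominus> x) < r"
        by (auto simp: eventually_sequentially)
      then have "s n \<in> mball x r"
        using hconv_carrier[OF s(2)] hnorm_diff_commute[of x "s n"] by (auto simp: hdist_eq)
      then show "\<exists>y\<in>D. y \<in> mball x r"
        using s(1) by blast
    qed
  qed
  then show ?thesis
    unfolding dense_in_def htop_def metric_closure_of set_eq_iff
    by (simp del: in_mball) blast
qed

text \<open>The sequence from \<open>D\<close> that approximates \<open>u\<close> itself is
  orthogonal to \<open>u\<close>, hence so is its limit \<open>u\<close>.\<close>

lemma dense_in_orthogonal_eq_zero: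
  assumes D: "dense_in H D" and u: "u \<in> carrier H" and orth: "\<And>x. x \<in> D \<Longrightarrow> \<langle>x, u\<rangle> = 0"
  shows "u = \<zero>"
proof -
  obtain s where s: "range s \<subseteq> D" "hconv H s u"
    using D u dense_in_iff by blast
  have "(\<lambda>n. \<langle>s n, u\<rangle>) \<longlonglongrightarrow> \<langle>u, u\<rangle>"
    using hconv_cinner[OF s(2) hconv_const[OF u]] .
  moreover have "\<langle>s n, u\<rangle> = 0" for n
    using s(1) orth by blast
  ultimately have "\<langle>u, u\<rangle> = 0"
    by (simp add: LIMSEQ_const_iff)
  then show ?thesis
    using u cinner_definite by blast
qed

end

section \<open>Riesz representation and orthogonal projection\<close>

context complex_hilbert_space
begin

lemma MCauchy_obtains_hconv:
  assumes "MCauchy s"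
  obtains l where "hconv H s l"
proof -
  have "range s \<subseteq> carrier H"
    using assms by (simp add: MCauchy_def)
  moreover obtain l where "limitin mtopology s l sequentially"
    using complete assms mcomplete_def by blast
  ultimately show ?thesis
    using that by (simp add: limitin_iff_hconv[symmetric] htop_def)
qed

text \<open>The representing vector is the limit of a minimising sequence of
  \<open>\<parallel>x\<parallel>\<^sup>2 - 2 Re (f x)\<close>, which is a Cauchy sequence by the parallelogram law.\<close>

lemma Riesz_linear_manifold:
  assumes D: "linear_manifold H D"
    and add: "\<And>x y. \<lbrakk>x \<in> D; y \<in> D\<rbrakk> \<Longrightarrow> f (x \<oplus> y) = f x + f y"
    and smult: "\<And>c x. x \<in> D \<Longrightarrow> f (c \<odot> x) = c * f x"
    and bound: "\<And>x. x \<in> D \<Longrightarrow> cmod (f x) \<le> C * hnorm H x"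
  obtains z s where "range s \<subseteq> D" "hconv H s z" "\<forall>x\<in>D. f x = \<langle>x, z\<rangle>"
proof -
  have sub [simp]: "x \<in> carrier H" if "x \<in> D" for x
    using D that by (auto simp: linear_manifold_def)
  have D_zero: "\<zero> \<in> D" and D_add: "\<And>x y. \<lbrakk>x \<in> D; y \<in> D\<rbrakk> \<Longrightarrow> x \<oplus> y \<in> D"
    and D_smult: "\<And>c x. x \<in> D \<Longrightarrow> c \<odot> x \<in> D"
    using D by (auto simp: linear_manifold_def)
  define F where "F x = (hnorm H x)\<^sup>2 - 2 * Re (f x)" for x
  \<comment> \<open>Completing the square: \<parallel>x\<parallel>^2 - 2 C \<parallel>x\<parallel> =
    (\<parallel>x\<parallel> - C)^2 - C^2.\<close>
  have F_lower: "- (C\<^sup>2) \<le> F x" if "x \<in> D" for x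
  proof -
    have "Re (f x) \<le> C * hnorm H x"
      using bound[OF that] complex_Re_le_cmod order_trans by blast
    moreover have "0 \<le> (hnorm H x - C)\<^sup>2"
      by simp
    ultimately show ?thesis
      by (simp add: F_def power2_diff mult.commute)
  qed
  define d where "d = (INF x\<in>D. F x)"
  have bdd: "bdd_below (F ` D)"
    using F_lower by (rule bdd_belowI2)
  have d_le: "d \<le> F x" if "x \<in> D" for x
    unfolding d_def using bdd that by (rule cINF_lower)
  have "\<exists>x\<in>D. F x < d + inverse (real (Suc n))" for n
    using cINF_less_iff[of D F "d + inverse (real (Suc n))"] D_zero bdd by (auto simp: d_def)
  then obtain s where sD: "\<And>n. s n \<in> D" and sF: "\<And>n. F (s n) < d + inverse (real (Suc n))"
    by metis
  have diff: "(hnorm H (x \<ominus> y))\<^sup>2 \<le> 2 * F x + 2 * F y - 4 * d" if "x \<in> D" "y \<in> D" for x y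
  proof -
    have "(hnorm H (x \<ominus> y))\<^sup>2 = 2 * F x + 2 * F y - 4 * F ((1/2) \<odot> (x \<oplus> y))"
      using that by (simp add: F_def hnorm_diff_power2 hnorm_smult power_mult_distrib
          hnorm_add_power2 smult add D_add power2_eq_square field_simps)
    also have "\<dots> \<le> 2 * F x + 2 * F y - 4 * d"
      using d_le that D_add D_smult by simp
    finally show ?thesis .
  qed
  have cauchy_est: "(hnorm H (s m \<ominus> s n))\<^sup>2 < 2 * inverse (real (Suc m)) + 2 * inverse (real (Suc n))" for m n
    using diff[OF sD sD, of m n] sF[of m] sF[of n] by linarith
  have "MCauchy s"
    unfolding MCauchy_def
  proof (intro conjI allI impI)
    fix e :: real
    assume e: "0 < e"
    \<comment> \<open>The divisor 4 matches the total weight 2 + 2 of the two reciprocals in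
      \<open>cauchy_est\<close>.\<close>
    obtain N where N: "inverse (real (Suc N)) < e\<^sup>2 / 4"
      using reals_Archimedean[of "e\<^sup>2 / 4"] e by auto
    have "hdist H (s n) (s n') < e" if "N \<le> n" "N \<le> n'" for n n'
    proof -
      have "inverse (real (Suc n)) \<le> inverse (real (Suc N))"
        "inverse (real (Suc n')) \<le> inverse (real (Suc N))"
        using that by (auto intro!: le_imp_inverse_le)
      then have "(hnorm H (s n \<ominus> s n'))\<^sup>2 < e\<^sup>2"
        using cauchy_est[of n n'] N by linarith
      then show ?thesis
        using e sD by (simp add: hdist_eq power_less_imp_less_base)
    qed
    then show "\<exists>N. \<forall>n n'. N \<le> n \<longrightarrow> N \<le> n' \<longrightarrow> hdist H (s n) (s n') < e"
      by blast
  qed (use sD in auto)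
  then obtain z where z: "hconv H s z"
    by (rule MCauchy_obtains_hconv)
  have Re_eq: "Re (f x) = Re \<langle>x, z\<rangle>" if x: "x \<in> D" for x
  proof -
    define a where "a = Re \<langle>z, x\<rangle> - Re (f x)"
    define b where "b = (hnorm H x)\<^sup>2"
    have b: "0 \<le> b"
      by (simp add: b_def)
    \<comment> \<open>The limit \<open>z\<close> may lie outside \<open>D\<close>, where nothing is
      known about \<open>f\<close>. Minimality is therefore tested at \<open>s n\<close>, which
      misses the infimum by less than 1/(n+1), and only the resulting inequality is passed to the
      limit.\<close>
    have ineq: "0 \<le> 2 * t * a + t\<^sup>2 * b" for t :: real
    proof -
      have "0 \<le> 2 * t * (Re \<langle>s n, x\<rangle> - Re (f x)) + t\<^sup>2 * b + inverse (real (Suc n))" for n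
      proof -
        have "d \<le> F (s n \<oplus> complex_of_real t \<odot> x)"
          using d_le sD x D_add D_smult by blast
        also have "\<dots> = F (s n) + 2 * t * (Re \<langle>s n, x\<rangle> - Re (f x)) + t\<^sup>2 * b"
          using x sD by (simp add: F_def b_def add D_smult smult hnorm_add_power2 hnorm_smult
              cinner_linear power_mult_distrib algebra_simps)
        finally show ?thesis
          using sF[of n] by linarith
      qed
      moreover have "(\<lambda>n. 2 * t * (Re \<langle>s n, x\<rangle> - Re (f x)) + t\<^sup>2 * b + inverse (real (Suc n)))
          \<longlonglongrightarrow> 2 * t * (Re \<langle>z, x\<rangle> - Re (f x)) + t\<^sup>2 * b + 0"
        by (intro tendsto_intros hconv_cinner[OF z] hconv_const LIMSEQ_inverse_real_of_nat sub x)
      ultimately have "0 \<le> 2 * t * (Re \<langle>z, x\<rangle> - Re (f x)) + t\<^sup>2 * b + 0"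
        by (intro LIMSEQ_le_const) auto
      then show ?thesis
        by (simp add: a_def)
    qed
    have "a = 0"
      using ineq b by (rule linear_coefficient_eq_0)
    then show ?thesis
      using Re_cinner_commute[of x z] x hconv_carrier[OF z] by (simp add: a_def)
  qed
  have "f x = \<langle>x, z\<rangle>" if x: "x \<in> D" for x
  proof (rule complex_eqI)
    \<comment> \<open>Real parts agree on all of \<open>D\<close>; applied to \<i> x they give the
      imaginary parts at \<open>x\<close>.\<close>
    show "Im (f x) = Im \<langle>x, z\<rangle>"
      using Re_eq[of "\<i> \<odot> x"] x hconv_carrier[OF z] by (simp add: D_smult smult cinner_linear)
  qed (rule Re_eq[OF x])
  then show ?thesis
    using that[of s z] z sD by blast
qed

text \<open>Riesz for the functional x \<mapsto> \<langle>x, u\<rangle> restricted to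
  \<open>D\<close>: the representing vector is the projection of \<open>u\<close> onto the closure
  of \<open>D\<close>.\<close>

lemma projection:
  assumes D: "linear_manifold H D" and u: "u \<in> carrier H"
  obtains z s where "range s \<subseteq> D" "hconv H s z" "\<forall>x\<in>D. \<langle>x, u \<ominus> z\<rangle> = 0"
proof -
  have sub: "x \<in> carrier H" if "x \<in> D" for x
    using D that by (auto simp: linear_manifold_def)
  obtain z s where *: "range s \<subseteq> D" "hconv H s z" "\<forall>x\<in>D. \<langle>x, u\<rangle> = \<langle>x, z\<rangle>"
  proof (rule Riesz_linear_manifold[OF D, where f = "\<lambda>x. \<langle>x, u\<rangle>" and C = "hnorm H u"])
    show "cmod \<langle>x, u\<rangle> \<le> hnorm H u * hnorm H x" if "x \<in> D" for x
      using Cauchy_Schwarz[OF sub[OF that] u] by (simp add: mult.commute)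
  qed (use sub u in \<open>auto simp: cinner_linear\<close>)
  show ?thesis
  proof (rule that[OF *(1,2)])
    show "\<forall>x\<in>D. \<langle>x, u \<ominus> z\<rangle> = 0"
      using *(3) sub u hconv_carrier[OF *(2)] by (simp add: cinner_linear)
  qed
qed

text \<open>The difference of \<open>u\<close> and its projection is orthogonal to \<open>D\<close>,
  hence zero, so \<open>u\<close> is itself a limit of vectors of \<open>D\<close>.\<close>

lemma dense_inI_orthogonal:
  assumes D: "linear_manifold H D"
    and "\<And>u. \<lbrakk>u \<in> carrier H; \<And>x. x \<in> D \<Longrightarrow> \<langle>x, u\<rangle> = 0\<rbrakk> \<Longrightarrow> u = \<zero>"
  shows "dense_in H D"
  unfolding dense_in_iff
proof (intro conjI ballI)
  fix u
  assume u: "u \<in> carrier H"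
  obtain z s where s: "range s \<subseteq> D" "hconv H s z" "\<forall>x\<in>D. \<langle>x, u \<ominus> z\<rangle> = 0"
    by (rule projection[OF D u])
  then have "u \<ominus> z = \<zero>"
    using assms(2)[of "u \<ominus> z"] u hconv_carrier[OF s(2)] by auto
  then have "u = z"
    using u hconv_carrier[OF s(2)] by (simp add: diff_eq_zero_iff)
  then show "\<exists>s. range s \<subseteq> D \<and> hconv H s u"
    using s by blast
qed (use D in \<open>auto simp: linear_manifold_def\<close>)

text \<open>Take w = u - z with \<open>z\<close> the projection; closedness puts \<open>z\<close>
  into \<open>D\<close>, so \<langle>u, w\<rangle> = \<parallel>u - z\<parallel>^2, which is
  nonzero.\<close>

lemma closed_manifold_separation:
  assumes D: "linear_manifold H D" and closed: "\<And>s l. \<lbrakk>range s \<subseteq> D; hconv H s l\<rbrakk> \<Longrightarrow> l \<in> D"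
    and u: "u \<in> carrier H" "u \<notin> D"
  obtains w where "w \<in> carrier H" "\<forall>x\<in>D. \<langle>x, w\<rangle> = 0" "\<langle>u, w\<rangle> \<noteq> 0"
proof -
  obtain z s where s: "range s \<subseteq> D" "hconv H s z" "\<forall>x\<in>D. \<langle>x, u \<ominus> z\<rangle> = 0"
    by (rule projection[OF D u(1)])
  have z: "z \<in> D" "z \<in> carrier H"
    using closed[OF s(1,2)] hconv_carrier(2)[OF s(2)] by auto
  have "\<langle>u, u \<ominus> z\<rangle> = \<langle>u \<ominus> z, u \<ominus> z\<rangle>"
    using u z s(3) cinner_diff_left[of u z "u \<ominus> z"] by simp
  moreover have "u \<ominus> z \<noteq> \<zero>"
    using u z by (metis diff_eq_zero_iff)
  ultimately have "\<langle>u, u \<ominus> z\<rangle> \<noteq> 0"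
    using cinner_definite[of "u \<ominus> z"] u z by auto
  then show ?thesis
    using that[of "u \<ominus> z"] s(3) u z by simp
qed

end

section \<open>Isometries and completions\<close>

text \<open>\<open>V\<close> is a bare record whose operations stay in its carrier. Injectivity of
  \<psi> lets each law of \<open>V\<close> be checked on images in \<open>H\<close>, which makes
  \<open>V\<close> an inner product space. The pattern serves twice: for the range of S with its new
  inner product, and for the completion.\<close>

locale linear_isometry = complex_inner_space H
  for V :: "'a inner_space" and H :: "'b inner_space" (structure) and \<psi> :: "'a \<Rightarrow> 'b" +
  assumes map_mem [simp]: "x \<in> carrier V \<Longrightarrow> \<psi> x \<in> carrier H"
    and map_inj: "inj_on \<psi> (carrier V)"
    and zero_mem [simp]: "\<zero>\<^bsub>V\<^esub> \<in> carrier V"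
    and add_mem [simp]: "\<lbrakk>x \<in> carrier V; y \<in> carrier V\<rbrakk> \<Longrightarrow> x \<oplus>\<^bsub>V\<^esub> y \<in> carrier V"
    and smult_V_mem [simp]: "x \<in> carrier V \<Longrightarrow> c \<odot>\<^bsub>V\<^esub> x \<in> carrier V"
    and map_zero [simp]: "\<psi> \<zero>\<^bsub>V\<^esub> = \<zero>"
    and map_add [simp]: "\<lbrakk>x \<in> carrier V; y \<in> carrier V\<rbrakk> \<Longrightarrow> \<psi> (x \<oplus>\<^bsub>V\<^esub> y) = \<psi> x \<oplus> \<psi> y"
    and map_smult [simp]: "x \<in> carrier V \<Longrightarrow> \<psi> (c \<odot>\<^bsub>V\<^esub> x) = c \<odot> \<psi> x"
    and map_cinner: "\<lbrakk>x \<in> carrier V; y \<in> carrier V\<rbrakk> \<Longrightarrow> \<langle>x, y\<rangle>\<^bsub>V\<^esub> = \<langle>\<psi> x, \<psi> y\<rangle>"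
begin

lemma eqI: "\<lbrakk>\<psi> x = \<psi> y; x \<in> carrier V; y \<in> carrier V\<rbrakk> \<Longrightarrow> x = y"
  using map_inj by (auto dest: inj_onD)

sublocale V: complex_inner_space V
proof (intro complex_inner_space.intro complex_inner_space_axioms.intro moduleI abelian_groupI)
  show "cring (cring_class_ops :: complex ring)"
    by (rule cring_class)
  show "\<exists>y\<in>carrier V. y \<oplus>\<^bsub>V\<^esub> x = \<zero>\<^bsub>V\<^esub>" if "x \<in> carrier V" for x
  proof (rule bexI[of _ "(-1) \<odot>\<^bsub>V\<^esub> x"], rule eqI)
    have "(-1) \<odot> \<psi> x \<oplus> \<psi> x = \<zero>"
      using that by (simp add: uminus_eq_smult[symmetric] M.l_neg)
    then show "\<psi> ((-1) \<odot>\<^bsub>V\<^esub> x \<oplus>\<^bsub>V\<^esub> x) = \<psi> \<zero>\<^bsub>V\<^esub>"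
      using that by simp
  qed (use that in auto)
  show "x \<oplus>\<^bsub>V\<^esub> y \<oplus>\<^bsub>V\<^esub> z = x \<oplus>\<^bsub>V\<^esub> (y \<oplus>\<^bsub>V\<^esub> z)"
    if "x \<in> carrier V" "y \<in> carrier V" "z \<in> carrier V" for x y z
    using that by (intro eqI) (simp_all add: M.a_assoc)
  show "x \<oplus>\<^bsub>V\<^esub> y = y \<oplus>\<^bsub>V\<^esub> x" if "x \<in> carrier V" "y \<in> carrier V" for x y
    using that by (intro eqI) (simp_all add: M.a_comm)
  show "\<zero>\<^bsub>V\<^esub> \<oplus>\<^bsub>V\<^esub> x = x" if "x \<in> carrier V" for x
    using that by (intro eqI) simp_all
  show "(a \<oplus>\<^bsub>cring_class_ops\<^esub> b) \<odot>\<^bsub>V\<^esub> x = a \<odot>\<^bsub>V\<^esub> x \<oplus>\<^bsub>V\<^esub> b \<odot>\<^bsub>V\<^esub> x"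
    if "x \<in> carrier V" for a b x
    using that smult_l_distr[of a b "\<psi> x"] by (intro eqI) (simp_all add: carrier_class)
  show "a \<odot>\<^bsub>V\<^esub> (x \<oplus>\<^bsub>V\<^esub> y) = a \<odot>\<^bsub>V\<^esub> x \<oplus>\<^bsub>V\<^esub> a \<odot>\<^bsub>V\<^esub> y"
    if "x \<in> carrier V" "y \<in> carrier V" for a x y
    using that by (intro eqI) (simp_all add: smult_r_distr carrier_class)
  show "(a \<otimes>\<^bsub>cring_class_ops\<^esub> b) \<odot>\<^bsub>V\<^esub> x = a \<odot>\<^bsub>V\<^esub> (b \<odot>\<^bsub>V\<^esub> x)"
    if "x \<in> carrier V" for a b x
    using that smult_assoc1[of a b "\<psi> x"] by (intro eqI) (simp_all add: carrier_class)
  show "\<one>\<^bsub>cring_class_ops\<^esub> \<odot>\<^bsub>V\<^esub> x = x" if "x \<in> carrier V" for x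
    using that by (intro eqI) simp_all
  show "\<langle>x, y\<rangle>\<^bsub>V\<^esub> = cnj \<langle>y, x\<rangle>\<^bsub>V\<^esub>" if "x \<in> carrier V" "y \<in> carrier V" for x y
    using that cinner_commute[of "\<psi> x" "\<psi> y"] by (simp add: map_cinner)
  show "x = \<zero>\<^bsub>V\<^esub>" if "x \<in> carrier V" "\<langle>x, x\<rangle>\<^bsub>V\<^esub> = 0" for x
    using that cinner_definite[of "\<psi> x"] by (intro eqI) (simp_all add: map_cinner)
qed (simp_all add: map_cinner cinner_linear cinner_nonneg)

lemma map_diff: "\<lbrakk>x \<in> carrier V; y \<in> carrier V\<rbrakk> \<Longrightarrow> \<psi> (x \<ominus>\<^bsub>V\<^esub> y) = \<psi> x \<ominus> \<psi> y"
  by (simp add: V.minus_eq_smult minus_eq_smult)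

lemma hnorm_map: "x \<in> carrier V \<Longrightarrow> hnorm V x = hnorm H (\<psi> x)"
  by (simp add: hnorm_def map_cinner)

lemma hdist_map: "\<lbrakk>x \<in> carrier V; y \<in> carrier V\<rbrakk> \<Longrightarrow> hdist V x y = hdist H (\<psi> x) (\<psi> y)"
  by (simp add: hdist_def hnorm_map map_diff)

lemma hconv_map:
  assumes s: "range s \<subseteq> carrier V" and l: "l \<in> carrier V"
  shows "hconv V s l \<longleftrightarrow> hconv H (\<psi> \<circ> s) (\<psi> l)"
proof -
  have "hnorm V (s n \<ominus>\<^bsub>V\<^esub> l) = hnorm H ((\<psi> \<circ> s) n \<ominus> \<psi> l)" for n
    using s l by (simp add: hnorm_map map_diff image_subset_iff)
  then show ?thesis
    using s l by (auto simp: hconv_def)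
qed

lemma MCauchy_map:
  assumes s: "range s \<subseteq> carrier V"
  shows "V.MCauchy s \<longleftrightarrow> MCauchy (\<psi> \<circ> s)"
proof -
  have "hdist V (s m) (s n) = hdist H ((\<psi> \<circ> s) m) ((\<psi> \<circ> s) n)" for m n
    using s by (simp add: hdist_map image_subset_iff)
  then show ?thesis
    using s by (auto simp: V.MCauchy_def MCauchy_def)
qed

text \<open>An isometric bijection carries Cauchy sequences to \<open>H\<close> and the limits found
  there back to \<open>V\<close>.\<close>

lemma complex_hilbert_space_V:
  assumes H: "complex_hilbert_space H" and surj: "\<psi> ` carrier V = carrier H"
  shows "complex_hilbert_space V"
proof (intro complex_hilbert_space.intro complex_hilbert_space_axioms.intro)
  interpret H: complex_hilbert_space H
    by (rule H)
  show "V.mcomplete"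
    unfolding V.mcomplete_def
  proof (intro allI impI)
    fix s
    assume s: "V.MCauchy s"
    then have ran: "range s \<subseteq> carrier V"
      by (simp add: V.MCauchy_def)
    then have "MCauchy (\<psi> \<circ> s)"
      using s MCauchy_map by blast
    then obtain h where h: "hconv H (\<psi> \<circ> s) h"
      by (rule H.MCauchy_obtains_hconv)
    then obtain l where l: "l \<in> carrier V" "h = \<psi> l"
      using surj hconv_carrier(2)[OF h] by auto
    then have "hconv V s l"
      using h hconv_map ran by blast
    then show "\<exists>x. limitin V.mtopology s x sequentially"
      using V.limitin_iff_hconv[OF ran] by (auto simp: htop_def)
  qed
qed (rule V.complex_inner_space_axioms)

end

text \<open>Here \<open>H\<close> is a concrete completion of \<open>V\<close>, against which the
  abstract quotient \<open>completion V\<close> is measured.\<close>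

locale dense_isometry = linear_isometry V H \<psi> + complex_hilbert_space H
  for V :: "'a inner_space" and H :: "'b inner_space" (structure) and \<psi> :: "'a \<Rightarrow> 'b" +
  assumes dense: "dense_in H (\<psi> ` carrier V)"
begin

text \<open>The vectors of the completion are parametrised by their limits in \<open>H\<close>.\<close>

definition limit_class :: "'b \<Rightarrow> (nat \<Rightarrow> 'a) set" where
  "limit_class h = {s. range s \<subseteq> carrier V \<and> hconv H (\<psi> \<circ> s) h}"

definition class_limit :: "(nat \<Rightarrow> 'a) set \<Rightarrow> 'b" where
  "class_limit = inv_into (carrier H) limit_class"

lemma limit_class_nonempty:
  assumes "h \<in> carrier H"
  shows "\<exists>s. s \<in> limit_class h"
proof -
  obtain t where t: "range t \<subseteq> \<psi> ` carrier V" "hconv H t h"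
    using dense assms dense_in_iff by blast
  have "\<forall>n. \<exists>x. x \<in> carrier V \<and> \<psi> x = t n"
    using t(1) by (metis image_iff range_subsetD)
  then obtain s where s: "\<And>n. s n \<in> carrier V" "\<And>n. \<psi> (s n) = t n"
    by metis
  then have "\<psi> \<circ> s = t"
    by auto
  then show ?thesis
    using s t(2) by (auto simp: limit_class_def)
qed

lemma mem_limit_class_unique: "\<lbrakk>s \<in> limit_class h; s \<in> limit_class h'\<rbrakk> \<Longrightarrow> h = h'"
  using hconv_unique by (auto simp: limit_class_def)

lemma inj_limit_class: "inj_on limit_class (carrier H)"
  using limit_class_nonempty mem_limit_class_unique by (metis inj_onI)

text \<open>Completeness of \<open>H\<close> enters here: the image of every Cauchy sequence of
  \<open>V\<close> has a limit that can serve as its label.\<close>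

lemma cauchy_seqs_eq: "cauchy_seqs V = (\<Union>h\<in>carrier H. limit_class h)"
proof (intro equalityI subsetI)
  fix s
  assume "s \<in> cauchy_seqs V"
  then have s: "V.MCauchy s" "range s \<subseteq> carrier V"
    by (auto simp: cauchy_seqs_def V.MCauchy_def)
  then have "MCauchy (\<psi> \<circ> s)"
    using MCauchy_map by blast
  then obtain h where "hconv H (\<psi> \<circ> s) h"
    by (rule MCauchy_obtains_hconv)
  moreover from this have "h \<in> carrier H"
    by (rule hconv_carrier)
  ultimately show "s \<in> (\<Union>h\<in>carrier H. limit_class h)"
    using s by (auto simp: limit_class_def)
next
  fix s
  assume "s \<in> (\<Union>h\<in>carrier H. limit_class h)"
  then show "s \<in> cauchy_seqs V"
    using MCauchy_map hconv_imp_MCauchy by (auto simp: limit_class_def cauchy_seqs_def)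
qed

text \<open>The distances of two Cauchy sequences converge to the distance of their limits in
  \<open>H\<close>, so being equivalent means having the same limit. This is what makes the
  representatives chosen by \<open>cauchy_rep\<close> irrelevant in the operations below.\<close>

lemma cauchy_class_eq:
  assumes s: "s \<in> limit_class h"
  shows "cauchy_class V s = limit_class h"
proof -
  have h: "h \<in> carrier H"
    using s hconv_carrier(2) by (auto simp: limit_class_def)
  have dist: "(\<lambda>n. hdist V (s n) (t n)) \<longlonglongrightarrow> hnorm H (h \<ominus> k)" if "t \<in> limit_class k" for t k
  proof -
    have "hdist V (s n) (t n) = hnorm H ((\<psi> \<circ> s) n \<ominus> (\<psi> \<circ> t) n)" for n
      using s that by (simp add: hdist_map hdist_eq limit_class_def image_subset_iff)
    moreover have "(\<lambda>n. hnorm H ((\<psi> \<circ> s) n \<ominus> (\<psi> \<circ> t) n)) \<longlonglongrightarrow> hnorm H (h \<ominus> k)"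
      using s that by (intro hconv_hnorm hconv_diff) (simp_all add: limit_class_def o_def)
    ultimately show ?thesis
      by simp
  qed
  have "t \<in> cauchy_class V s \<longleftrightarrow> t \<in> limit_class h" for t
  proof
    assume "t \<in> cauchy_class V s"
    then have t: "t \<in> cauchy_seqs V" "(\<lambda>n. hdist V (s n) (t n)) \<longlonglongrightarrow> 0"
      by (auto simp: cauchy_class_def cauchy_rel_def)
    then obtain k where k: "k \<in> carrier H" "t \<in> limit_class k"
      by (auto simp: cauchy_seqs_eq)
    then have "hnorm H (h \<ominus> k) = 0"
      using dist t(2) LIMSEQ_unique by blast
    then show "t \<in> limit_class h"
      using h k by (simp add: hnorm_eq_0_iff diff_eq_zero_iff)
  next
    assume t: "t \<in> limit_class h"
    then show "t \<in> cauchy_class V s"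
      using s dist[OF t] h by (auto simp: cauchy_class_def cauchy_rel_def cauchy_seqs_eq)
  qed
  then show ?thesis
    by blast
qed

lemma const_mem_limit_class: "x \<in> carrier V \<Longrightarrow> (\<lambda>_. x) \<in> limit_class (\<psi> x)"
  using hconv_const[of "\<psi> x"] by (simp add: limit_class_def o_def image_subset_iff)

lemma cauchy_class_const: "x \<in> carrier V \<Longrightarrow> cauchy_class V (\<lambda>_. x) = limit_class (\<psi> x)"
  by (rule cauchy_class_eq) (rule const_mem_limit_class)

lemma cauchy_rep_mem: "h \<in> carrier H \<Longrightarrow> cauchy_rep (limit_class h) \<in> limit_class h"
  unfolding cauchy_rep_def using limit_class_nonempty by (rule someI_ex)

lemma completion_carrier: "carrier (completion V) = limit_class ` carrier H"
proof -
  have "carrier (completion V) = cauchy_class V ` cauchy_seqs V"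
    by (auto simp: completion_def quotient_def cauchy_class_def)
  also have "\<dots> = limit_class ` carrier H"
    using cauchy_class_eq limit_class_nonempty
    by (fastforce simp: cauchy_seqs_eq image_iff)
  finally show ?thesis .
qed

lemma completion_zero: "\<zero>\<^bsub>completion V\<^esub> = limit_class \<zero>"
  using cauchy_class_const[of "\<zero>\<^bsub>V\<^esub>"] by (simp add: completion_def)

lemma completion_add:
  assumes "h \<in> carrier H" "k \<in> carrier H"
  shows "limit_class h \<oplus>\<^bsub>completion V\<^esub> limit_class k = limit_class (h \<oplus> k)"
proof -
  define s t where st: "s = cauchy_rep (limit_class h)" "t = cauchy_rep (limit_class k)"
  have s: "s \<in> limit_class h" and t: "t \<in> limit_class k"
    using assms cauchy_rep_mem by (simp_all add: st)
  have "\<psi> \<circ> (\<lambda>n. s n \<oplus>\<^bsub>V\<^esub> t n) = (\<lambda>n. (\<psi> \<circ> s) n \<oplus> (\<psi> \<circ> t) n)"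
    using s t by (auto simp: limit_class_def image_subset_iff)
  then have "(\<lambda>n. s n \<oplus>\<^bsub>V\<^esub> t n) \<in> limit_class (h \<oplus> k)"
    using s t hconv_add[of "\<psi> \<circ> s" h "\<psi> \<circ> t" k] by (simp add: limit_class_def image_subset_iff)
  then show ?thesis
    by (simp add: completion_def st cauchy_class_eq)
qed

lemma completion_smult:
  assumes "h \<in> carrier H"
  shows "c \<odot>\<^bsub>completion V\<^esub> limit_class h = limit_class (c \<odot> h)"
proof -
  define s where s_def: "s = cauchy_rep (limit_class h)"
  have s: "s \<in> limit_class h"
    using assms cauchy_rep_mem by (simp add: s_def)
  have "\<psi> \<circ> (\<lambda>n. c \<odot>\<^bsub>V\<^esub> s n) = (\<lambda>n. c \<odot> (\<psi> \<circ> s) n)"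
    using s by (auto simp: limit_class_def image_subset_iff)
  then have "(\<lambda>n. c \<odot>\<^bsub>V\<^esub> s n) \<in> limit_class (c \<odot> h)"
    using s hconv_smult[of "\<psi> \<circ> s" h c] by (simp add: limit_class_def image_subset_iff)
  then show ?thesis
    by (simp add: completion_def s_def cauchy_class_eq)
qed

lemma completion_cinner:
  assumes "h \<in> carrier H" "k \<in> carrier H"
  shows "\<langle>limit_class h, limit_class k\<rangle>\<^bsub>completion V\<^esub> = \<langle>h, k\<rangle>"
proof -
  define s t where st: "s = cauchy_rep (limit_class h)" "t = cauchy_rep (limit_class k)"
  have s: "s \<in> limit_class h" and t: "t \<in> limit_class k"
    using assms cauchy_rep_mem by (simp_all add: st)
  have "\<langle>s n, t n\<rangle>\<^bsub>V\<^esub> = \<langle>(\<psi> \<circ> s) n, (\<psi> \<circ> t) n\<rangle>" for n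
    using s t by (simp add: limit_class_def image_subset_iff map_cinner)
  then have "(\<lambda>n. \<langle>s n, t n\<rangle>\<^bsub>V\<^esub>) \<longlonglongrightarrow> \<langle>h, k\<rangle>"
    using s t hconv_cinner[of "\<psi> \<circ> s" h "\<psi> \<circ> t" k] by (simp add: limit_class_def)
  then show ?thesis
    by (simp add: completion_def st limI)
qed

lemma class_limit_limit_class: "h \<in> carrier H \<Longrightarrow> class_limit (limit_class h) = h"
  by (simp add: class_limit_def inv_into_f_f inj_limit_class)

lemma limit_class_class_limit:
  "X \<in> carrier (completion V) \<Longrightarrow> limit_class (class_limit X) = X"
  by (auto simp: completion_carrier class_limit_limit_class)

lemma class_limit_image: "class_limit ` carrier (completion V) = carrier H"
  by (force simp: completion_carrier class_limit_limit_class image_iff)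

text \<open>The second use of the transport pattern: the classes obey the inner product laws because
  their limits in \<open>H\<close> do.\<close>

sublocale completion: linear_isometry "completion V" H class_limit
proof
  show "inj_on class_limit (carrier (completion V))"
    by (metis inj_onI limit_class_class_limit)
qed (auto simp: completion_carrier completion_zero completion_add completion_smult
    completion_cinner class_limit_limit_class)

lemma complex_hilbert_space_completion: "complex_hilbert_space (completion V)"
  by (rule completion.complex_hilbert_space_V[OF complex_hilbert_space_axioms class_limit_image])

lemma hconv_completion:
  "hconv (completion V) X Y \<longleftrightarrow> range X \<subseteq> carrier (completion V) \<and>
     Y \<in> carrier (completion V) \<and> hconv H (class_limit \<circ> X) (class_limit Y)"
  using completion.hconv_map[of X Y] by (auto simp: hconv_def)

end

section \<open>Products and operators\<close>

text \<open>Gives graphs an ambient Hilbert space, in which the graph of a closed operator is a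
  closed linear manifold and projection applies.\<close>

definition prod_space :: "'a inner_space \<Rightarrow> 'b inner_space \<Rightarrow> ('a \<times> 'b) inner_space" where
  "prod_space K H = \<lparr>carrier = carrier K \<times> carrier H, mult = (\<lambda>_ _. undefined), one = undefined,
     zero = (\<zero>\<^bsub>K\<^esub>, \<zero>\<^bsub>H\<^esub>),
     add = (\<lambda>p q. (fst p \<oplus>\<^bsub>K\<^esub> fst q, snd p \<oplus>\<^bsub>H\<^esub> snd q)),
     smult = (\<lambda>c p. (c \<odot>\<^bsub>K\<^esub> fst p, c \<odot>\<^bsub>H\<^esub> snd p)),
     cinner = (\<lambda>p q. \<langle>fst p, fst q\<rangle>\<^bsub>K\<^esub> + \<langle>snd p, snd q\<rangle>\<^bsub>H\<^esub>)\<rparr>"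

lemma prod_space_simps [simp]:
  "carrier (prod_space K H) = carrier K \<times> carrier H"
  "\<zero>\<^bsub>prod_space K H\<^esub> = (\<zero>\<^bsub>K\<^esub>, \<zero>\<^bsub>H\<^esub>)"
  "p \<oplus>\<^bsub>prod_space K H\<^esub> q = (fst p \<oplus>\<^bsub>K\<^esub> fst q, snd p \<oplus>\<^bsub>H\<^esub> snd q)"
  "c \<odot>\<^bsub>prod_space K H\<^esub> p = (c \<odot>\<^bsub>K\<^esub> fst p, c \<odot>\<^bsub>H\<^esub> snd p)"
  "\<langle>p, q\<rangle>\<^bsub>prod_space K H\<^esub> = \<langle>fst p, fst q\<rangle>\<^bsub>K\<^esub> + \<langle>snd p, snd q\<rangle>\<^bsub>H\<^esub>"
  by (simp_all add: prod_space_def)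

locale inner_space_pair = K: complex_inner_space K + H: complex_inner_space H
  for K :: "'a inner_space" and H :: "'b inner_space"
begin

lemma complex_inner_space_prod: "complex_inner_space (prod_space K H)"
proof (intro complex_inner_space.intro complex_inner_space_axioms.intro moduleI abelian_groupI)
  show "cring (cring_class_ops :: complex ring)"
    by (rule cring_class)
  show "\<exists>q\<in>carrier (prod_space K H). q \<oplus>\<^bsub>prod_space K H\<^esub> p = \<zero>\<^bsub>prod_space K H\<^esub>"
    if "p \<in> carrier (prod_space K H)" for p
    using that by (intro bexI[of _ "(\<ominus>\<^bsub>K\<^esub> fst p, \<ominus>\<^bsub>H\<^esub> snd p)"]) (auto simp: K.M.l_neg H.M.l_neg)
  show "\<langle>p, q\<rangle>\<^bsub>prod_space K H\<^esub> = cnj \<langle>q, p\<rangle>\<^bsub>prod_space K H\<^esub>"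
    if "p \<in> carrier (prod_space K H)" "q \<in> carrier (prod_space K H)" for p q
    using that K.cinner_commute[of "fst p" "fst q"] H.cinner_commute[of "snd p" "snd q"]
    by (auto simp: mem_Times_iff)
  show "p = \<zero>\<^bsub>prod_space K H\<^esub>"
    if "p \<in> carrier (prod_space K H)" "\<langle>p, p\<rangle>\<^bsub>prod_space K H\<^esub> = 0" for p
  proof -
    have "(hnorm K (fst p))\<^sup>2 + (hnorm H (snd p))\<^sup>2 = 0"
      using that by (auto simp: mem_Times_iff K.cinner_self H.cinner_self simp flip: of_real_add of_real_power)
    then show ?thesis
      using that by (auto simp: mem_Times_iff sum_power2_eq_zero_iff K.hnorm_eq_0_iff H.hnorm_eq_0_iff prod_eq_iff)
  qed
qed (auto simp: K.smult_l_distr K.smult_r_distr K.smult_assoc1 H.smult_l_distr H.smult_r_distr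
    H.smult_assoc1 K.M.a_ac H.M.a_ac K.cinner_linear H.cinner_linear K.cinner_nonneg H.cinner_nonneg
    carrier_class algebra_simps)

sublocale P: complex_inner_space "prod_space K H"
  by (rule complex_inner_space_prod)

lemma prod_space_diff:
  "\<lbrakk>p \<in> carrier K \<times> carrier H; q \<in> carrier K \<times> carrier H\<rbrakk> \<Longrightarrow>
    p \<ominus>\<^bsub>prod_space K H\<^esub> q = (fst p \<ominus>\<^bsub>K\<^esub> fst q, snd p \<ominus>\<^bsub>H\<^esub> snd q)"
  by (auto simp: P.minus_eq_smult K.minus_eq_smult H.minus_eq_smult)

text \<open>The norm distance of the product is exactly the library's product metric, which links
  projection in \<open>prod_space\<close> with closedness in \<open>prod_topology\<close>.\<close>

lemma hdist_prod_space:
  assumes "p \<in> carrier K \<times> carrier H" "q \<in> carrier K \<times> carrier H"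
  shows "hdist (prod_space K H) p q = prod_dist (hdist K) (hdist H) p q"
proof -
  have "hdist (prod_space K H) p q = sqrt ((hnorm K (fst p \<ominus>\<^bsub>K\<^esub> fst q))\<^sup>2 + (hnorm H (snd p \<ominus>\<^bsub>H\<^esub> snd q))\<^sup>2)"
    using assms by (subst P.hdist_eq)
      (auto simp: prod_space_diff hnorm_def[of "prod_space K H"] K.hnorm_power2 H.hnorm_power2)
  then show ?thesis
    using assms by (auto simp: prod_dist_def K.hdist_eq H.hdist_eq)
qed

sublocale M: Metric_space12 "carrier K" "hdist K" "carrier H" "hdist H" ..

lemma limitin_prod_htop:
  assumes "range s \<subseteq> carrier K \<times> carrier H"
  shows "limitin (prod_topology (htop K) (htop H)) s l sequentially \<longleftrightarrow>
    hconv K (fst \<circ> s) (fst l) \<and> hconv H (snd \<circ> s) (snd l)"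
proof -
  have "range (fst \<circ> s) \<subseteq> carrier K" "range (snd \<circ> s) \<subseteq> carrier H"
    using assms by (auto simp: image_subset_iff mem_Times_iff)
  then show ?thesis
    by (simp add: limitin_pairwise K.limitin_iff_hconv H.limitin_iff_hconv)
qed

lemma hconv_prod_space:
  "hconv (prod_space K H) s l \<longleftrightarrow> hconv K (fst \<circ> s) (fst l) \<and> hconv H (snd \<circ> s) (snd l)"
  if s: "range s \<subseteq> carrier K \<times> carrier H"
proof -
  have "hdist (prod_space K H) (s n) l = prod_dist (hdist K) (hdist H) (s n) l"
    if "l \<in> carrier K \<times> carrier H" for n
    using s that by (intro hdist_prod_space) auto
  then have "limitin (htop (prod_space K H)) s l sequentially \<longleftrightarrow>
      limitin M.Prod_metric.mtopology s l sequentially"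
    unfolding htop_def P.limitin_metric_dist_null M.Prod_metric.limitin_metric_dist_null
    by (auto cong: conj_cong)
  then show ?thesis
    using s limitin_prod_htop[OF s, of l] P.limitin_iff_hconv[of s l]
    by (simp add: M.mtopology_prod_metric htop_def)
qed

text \<open>The product topology is metrised by the product metric, so sequences decide closedness
  of a graph.\<close>

lemma closedin_prod_htop_iff:
  "closedin (prod_topology (htop K) (htop H)) T \<longleftrightarrow> T \<subseteq> carrier K \<times> carrier H \<and>
     (\<forall>s a b. range s \<subseteq> T \<longrightarrow> hconv K (fst \<circ> s) a \<longrightarrow> hconv H (snd \<circ> s) b \<longrightarrow> (a, b) \<in> T)"
proof -
  have "closedin (prod_topology (htop K) (htop H)) T \<longleftrightarrow> T \<subseteq> carrier K \<times> carrier H \<and>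
     (\<forall>s l. range s \<subseteq> T \<and> limitin (prod_topology (htop K) (htop H)) s l sequentially \<longrightarrow> l \<in> T)"
    unfolding htop_def M.mtopology_prod_metric[symmetric]
    by (rule M.Prod_metric.metric_closedin_iff_sequentially_closed)
  also have "\<dots> \<longleftrightarrow> T \<subseteq> carrier K \<times> carrier H \<and>
     (\<forall>s l. range s \<subseteq> T \<longrightarrow> hconv K (fst \<circ> s) (fst l) \<longrightarrow> hconv H (snd \<circ> s) (snd l) \<longrightarrow> l \<in> T)"
  proof (rule conj_cong[OF refl], intro all_cong1)
    fix s and l :: "'a \<times> 'b"
    assume T: "T \<subseteq> carrier K \<times> carrier H"
    show "(range s \<subseteq> T \<and> limitin (prod_topology (htop K) (htop H)) s l sequentially \<longrightarrow> l \<in> T) \<longleftrightarrow>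
      (range s \<subseteq> T \<longrightarrow> hconv K (fst \<circ> s) (fst l) \<longrightarrow> hconv H (snd \<circ> s) (snd l) \<longrightarrow> l \<in> T)"
    proof (cases "range s \<subseteq> T")
      case True
      then show ?thesis
        by (simp add: limitin_prod_htop[OF order_trans[OF True T]] imp_conjL)
    qed simp
  qed
  finally show ?thesis
    by simp
qed

end

locale hilbert_space_pair = K: complex_hilbert_space K + H: complex_hilbert_space H
  for K :: "'a inner_space" and H :: "'b inner_space"
begin

sublocale inner_space_pair ..

sublocale P: complex_hilbert_space "prod_space K H"
proof
  show "P.mcomplete"
    unfolding P.mcomplete_def
  proof (intro allI impI)
    fix s
    assume s: "P.MCauchy s"
    then have ran: "range s \<subseteq> carrier K \<times> carrier H"
      unfolding P.MCauchy_def by simp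
    then have "hdist (prod_space K H) (s m) (s n) = prod_dist (hdist K) (hdist H) (s m) (s n)" for m n
      by (intro hdist_prod_space) auto
    then have "M.Prod_metric.MCauchy s"
      using s unfolding P.MCauchy_def M.Prod_metric.MCauchy_def by simp
    then have c: "K.MCauchy (fst \<circ> s)" "H.MCauchy (snd \<circ> s)"
      by (simp_all add: M.MCauchy_prod_metric)
    obtain a where a: "hconv K (fst \<circ> s) a"
      using c(1) by (rule K.MCauchy_obtains_hconv)
    obtain b where b: "hconv H (snd \<circ> s) b"
      using c(2) by (rule H.MCauchy_obtains_hconv)
    have "hconv (prod_space K H) s (a, b)"
      using a b ran by (simp add: hconv_prod_space)
    then show "\<exists>x. limitin P.mtopology s x sequentially"
      using P.limitin_iff_hconv[of s] ran by (auto simp: htop_def)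
  qed
qed

end

lemma Ball_pair_iff: "(\<forall>(x, y)\<in>T. P x y) \<longleftrightarrow> (\<forall>x y. (x, y) \<in> T \<longrightarrow> P x y)"
  by auto

lemma linear_operatorD:
  assumes "linear_operator K H T"
  shows "(x, y) \<in> T \<Longrightarrow> x \<in> carrier K" "(x, y) \<in> T \<Longrightarrow> y \<in> carrier H"
    and "\<lbrakk>(x, y) \<in> T; (x, y') \<in> T\<rbrakk> \<Longrightarrow> y = y'"
    and "(\<zero>\<^bsub>K\<^esub>, \<zero>\<^bsub>H\<^esub>) \<in> T"
    and "\<lbrakk>(x, y) \<in> T; (x', y') \<in> T\<rbrakk> \<Longrightarrow> (x \<oplus>\<^bsub>K\<^esub> x', y \<oplus>\<^bsub>H\<^esub> y') \<in> T"
    and "(x, y) \<in> T \<Longrightarrow> (c \<odot>\<^bsub>K\<^esub> x, c \<odot>\<^bsub>H\<^esub> y) \<in> T"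
  using assms unfolding linear_operator_def single_valued_def Ball_pair_iff by blast+

lemma linear_operator_converse:
  assumes "linear_operator K H T" "single_valued (T\<inverse>)"
  shows "linear_operator H K (T\<inverse>)"
  unfolding linear_operator_def Ball_pair_iff
  using linear_operatorD[OF assms(1)] assms(2) by simp blast

lemma linear_operator_relcomp:
  assumes T: "linear_operator K H T" and U: "linear_operator H L U"
  shows "linear_operator K L (T O U)"
  unfolding linear_operator_def
proof (intro conjI)
  show "single_valued (T O U)"
    using T U by (simp add: linear_operator_def single_valued_relcomp)
  show "T O U \<subseteq> carrier K \<times> carrier L"
    using linear_operatorD(1)[OF T] linear_operatorD(2)[OF U] by auto
qed (unfold Ball_pair_iff, use linear_operatorD(4-6)[OF T] linear_operatorD(4-6)[OF U] in \<open>blast+\<close>)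

lemma linear_manifold_Domain:
  assumes "linear_operator K H T"
  shows "linear_manifold K (Domain T)"
  unfolding linear_manifold_def
  using linear_operatorD(1,4-6)[OF assms] by blast

lemma linear_manifold_Range:
  assumes "linear_operator K H T"
  shows "linear_manifold H (Range T)"
  unfolding linear_manifold_def
  using linear_operatorD(2,4-6)[OF assms] by blast

lemma linear_manifold_graph:
  assumes "linear_operator K H T"
  shows "linear_manifold (prod_space K H) T"
  unfolding linear_manifold_def
  using linear_operatorD[OF assms] by auto

section \<open>Unitary extension of isometric operators\<close>

text \<open>Cauchy-Schwarz bounds every quotient by the norm; along a sequence from \<open>D\<close>
  converging to \<open>z\<close> the quotients tend to \<langle>z, z\<rangle> /
  \<parallel>z\<parallel>. For \<open>z = \<zero>\<close> the left side is 0, whatever the index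
  set.\<close>

lemma (in complex_inner_space) hnorm_eq_SUP:
  assumes D: "dense_in H D" and z: "z \<in> carrier H"
  shows "ennreal (hnorm H z) = (SUP x\<in>{x \<in> D. x \<noteq> \<zero>}. ennreal (cmod \<langle>x, z\<rangle> / hnorm H x))"
    (is "_ = ?R")
proof (rule antisym)
  have sub: "x \<in> carrier H" if "x \<in> D" for x
    using D that by (auto simp: dense_in_def)
  show "?R \<le> ennreal (hnorm H z)"
  proof (rule SUP_least)
    fix x
    assume "x \<in> {x \<in> D. x \<noteq> \<zero>}"
    then have x: "x \<in> carrier H" "0 < hnorm H x"
      using sub hnorm_eq_0_iff hnorm_nonneg by (auto simp: less_le)
    have "cmod \<langle>x, z\<rangle> \<le> hnorm H z * hnorm H x"
      using Cauchy_Schwarz[OF x(1) z] by (simp add: mult.commute)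
    then show "ennreal (cmod \<langle>x, z\<rangle> / hnorm H x) \<le> ennreal (hnorm H z)"
      using x by (intro ennreal_leI) (simp add: pos_divide_le_eq)
  qed
  show "ennreal (hnorm H z) \<le> ?R"
  proof (cases "z = \<zero>")
    case False
    then have pos: "0 < hnorm H z"
      using z hnorm_eq_0_iff[OF z] hnorm_nonneg[OF z] by linarith
    obtain s where s: "range s \<subseteq> D" "hconv H s z"
      using D z dense_in_iff by blast
    have "(\<lambda>n. cmod \<langle>s n, z\<rangle> / hnorm H (s n)) \<longlonglongrightarrow> cmod \<langle>z, z\<rangle> / hnorm H z"
      using pos by (intro tendsto_intros hconv_cinner hconv_const hconv_hnorm s z) simp
    also have "cmod \<langle>z, z\<rangle> / hnorm H z = hnorm H z"
      unfolding cinner_self[OF z] norm_of_real using pos by (simp add: monoid_mult_class.power2_eq_square)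
    finally have lim: "(\<lambda>n. ennreal (cmod \<langle>s n, z\<rangle> / hnorm H (s n))) \<longlonglongrightarrow> ennreal (hnorm H z)"
      by (rule tendsto_ennrealI)
    \<comment> \<open>The index set of the supremum excludes the zero vector; \<open>s n\<close>
      avoids it eventually, since its norms tend to a positive number.\<close>
    have "\<forall>\<^sub>F n in sequentially. 0 < hnorm H (s n)"
      using hconv_hnorm[OF s(2)] pos by (rule order_tendstoD)
    then have "\<forall>\<^sub>F n in sequentially. ennreal (cmod \<langle>s n, z\<rangle> / hnorm H (s n)) \<le> ?R"
    proof eventually_elim
      case (elim n)
      then have "s n \<noteq> \<zero>"
        by auto
      then show ?case
        using s(1) by (intro SUP_upper) auto
    qed
    with lim show ?thesis
      by (rule tendsto_upperbound) simp
  qed simp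
qed

context inner_space_pair
begin

lemma linear_operator_diff:
  assumes T: "linear_operator K H T" and "(x, y) \<in> T" "(x', y') \<in> T"
  shows "(x \<ominus>\<^bsub>K\<^esub> x', y \<ominus>\<^bsub>H\<^esub> y') \<in> T"
proof -
  have "(x \<oplus>\<^bsub>K\<^esub> (-1) \<odot>\<^bsub>K\<^esub> x', y \<oplus>\<^bsub>H\<^esub> (-1) \<odot>\<^bsub>H\<^esub> y') \<in> T"
    using assms linear_operatorD(5,6)[OF T] by blast
  then show ?thesis
    using assms(2,3) linear_operatorD(1,2)[OF T] by (simp add: K.minus_eq_smult H.minus_eq_smult)
qed

text \<open>Polarisation: norms of sums determine real parts, and replacing \<open>x\<close> by \<i>
  x turns imaginary parts into real ones.\<close>

lemma isometric_cinner:
  assumes T: "linear_operator K H T" and iso: "\<And>x y. (x, y) \<in> T \<Longrightarrow> hnorm H y = hnorm K x"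
    and xy: "(x, y) \<in> T" "(x', y') \<in> T"
  shows "\<langle>y, y'\<rangle>\<^bsub>H\<^esub> = \<langle>x, x'\<rangle>\<^bsub>K\<^esub>"
proof -
  have Re: "Re \<langle>v, v'\<rangle>\<^bsub>H\<^esub> = Re \<langle>u, u'\<rangle>\<^bsub>K\<^esub>" if "(u, v) \<in> T" "(u', v') \<in> T" for u v u' v'
    using iso[OF linear_operatorD(5)[OF T that]] iso[OF that(1)] iso[OF that(2)]
      K.hnorm_add_power2[of u u'] H.hnorm_add_power2[of v v'] linear_operatorD(1,2)[OF T] that by simp
  show ?thesis
    using Re[OF xy] Re[OF linear_operatorD(6)[OF T xy(1), of \<i>] xy(2)] linear_operatorD(1,2)[OF T] xy
    by (auto simp: complex_eq_iff K.cinner_linear H.cinner_linear)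
qed

lemma isometric_converse_single_valued:
  assumes T: "linear_operator K H T" and iso: "\<And>x y. (x, y) \<in> T \<Longrightarrow> hnorm H y = hnorm K x"
  shows "single_valued (T\<inverse>)"
proof (rule single_valuedI)
  fix y x x'
  assume "(y, x) \<in> T\<inverse>" "(y, x') \<in> T\<inverse>"
  then have xy: "(x, y) \<in> T" "(x', y) \<in> T"
    by auto
  then have "hnorm K (x \<ominus>\<^bsub>K\<^esub> x') = hnorm H (y \<ominus>\<^bsub>H\<^esub> y)"
    using linear_operator_diff[OF T] iso by metis
  then show "x = x'"
    using xy linear_operatorD(1,2)[OF T] by (simp add: K.hnorm_eq_0_iff K.diff_eq_zero_iff)
qed

text \<open>An isometric graph maps an approximating sequence of \<open>x\<close> to a Cauchy
  sequence, and completeness of the target supplies its limit.\<close>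

lemma isometric_limit:
  assumes H: "complex_hilbert_space H"
    and T: "linear_operator K H T" and iso: "\<And>x y. (x, y) \<in> T \<Longrightarrow> hnorm H y = hnorm K x"
    and dense: "dense_in K (Domain T)" and x: "x \<in> carrier K"
  obtains s y where "range s \<subseteq> T" "hconv K (fst \<circ> s) x" "hconv H (snd \<circ> s) y"
proof -
  interpret H: complex_hilbert_space H
    by (rule H)
  obtain t where t: "range t \<subseteq> Domain T" "hconv K t x"
    using dense x K.dense_in_iff by blast
  have "\<forall>n. \<exists>y. (t n, y) \<in> T"
    using t(1) by blast
  then obtain r where r: "\<And>n. (t n, r n) \<in> T"
    by metis
  have tr: "t n \<in> carrier K" "r n \<in> carrier H" for n
    using r linear_operatorD(1,2)[OF T] by blast+
  have "hdist H (r m) (r n) = hdist K (t m) (t n)" for m n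
    using iso[OF linear_operator_diff[OF T r r]] tr by (simp add: H.hdist_eq K.hdist_eq)
  then have "H.MCauchy r"
    using K.hconv_imp_MCauchy[OF t(2)] tr by (auto simp: H.MCauchy_def K.MCauchy_def)
  then obtain y where "hconv H r y"
    by (rule H.MCauchy_obtains_hconv)
  then show ?thesis
    using that[of "\<lambda>n. (t n, r n)" y] r t(2) by (auto simp: o_def)
qed

end

lemma (in hilbert_space_pair) ex1_unitary_extension:
  assumes T: "linear_operator K H T" and iso: "\<And>x y. (x, y) \<in> T \<Longrightarrow> hnorm H y = hnorm K x"
    and dom: "dense_in K (Domain T)" and ran: "dense_in H (Range T)"
  shows "\<exists>!\<Phi>. unitary_operator K H \<Phi> \<and> T \<subseteq> \<Phi>"
proof -
  \<comment> \<open>The closure of the graph of \<open>T\<close>. Working with pairs of limits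
    defers single-valuedness to the preservation of inner products.\<close>
  define \<Phi> where "\<Phi> = {(x, y). \<exists>s. range s \<subseteq> T \<and> hconv K (fst \<circ> s) x \<and> hconv H (snd \<circ> s) y}"
  have \<Phi>I: "(x, y) \<in> \<Phi>" if "range s \<subseteq> T" "hconv K (fst \<circ> s) x" "hconv H (snd \<circ> s) y" for s x y
    using that by (auto simp: \<Phi>_def)
  have \<Phi>E: "\<exists>u v. (\<forall>n. (u n, v n) \<in> T) \<and> hconv K u x \<and> hconv H v y" if xy: "(x, y) \<in> \<Phi>" for x y
  proof -
    obtain s where s: "range s \<subseteq> T" "hconv K (fst \<circ> s) x" "hconv H (snd \<circ> s) y"
      using xy by (auto simp: \<Phi>_def)
    have "\<forall>n. ((fst \<circ> s) n, (snd \<circ> s) n) \<in> T"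
      using s(1) by auto
    then show ?thesis
      using s(2,3) by blast
  qed
  have T_sub: "T \<subseteq> \<Phi>"
  proof
    fix p
    assume p: "p \<in> T"
    then have c: "fst p \<in> carrier K" "snd p \<in> carrier H"
      using linear_operatorD(1,2)[OF T] by (metis prod.collapse)+
    have "(fst p, snd p) \<in> \<Phi>"
      by (rule \<Phi>I[of "\<lambda>_. p"]) (use p c K.hconv_const H.hconv_const in \<open>auto simp: o_def\<close>)
    then show "p \<in> \<Phi>"
      by simp
  qed
  have \<Phi>_cinner: "\<langle>y, y'\<rangle>\<^bsub>H\<^esub> = \<langle>x, x'\<rangle>\<^bsub>K\<^esub>" if xy: "(x, y) \<in> \<Phi>" "(x', y') \<in> \<Phi>" for x y x' y'
  proof -
    obtain u v u' v' where uv: "\<forall>n. (u n, v n) \<in> T" "hconv K u x" "hconv H v y"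
      "\<forall>n. (u' n, v' n) \<in> T" "hconv K u' x'" "hconv H v' y'"
      using \<Phi>E[OF xy(1)] \<Phi>E[OF xy(2)] by blast
    have "\<langle>v n, v' n\<rangle>\<^bsub>H\<^esub> = \<langle>u n, u' n\<rangle>\<^bsub>K\<^esub>" for n
      using isometric_cinner[OF T iso] uv by blast
    then have "(\<lambda>n. \<langle>u n, u' n\<rangle>\<^bsub>K\<^esub>) \<longlonglongrightarrow> \<langle>y, y'\<rangle>\<^bsub>H\<^esub>"
      using H.hconv_cinner[OF uv(3,6)] by simp
    then show ?thesis
      using K.hconv_cinner[OF uv(2,5)] LIMSEQ_unique by blast
  qed
  have \<Phi>_car: "x \<in> carrier K \<and> y \<in> carrier H" if "(x, y) \<in> \<Phi>" for x y
    using \<Phi>E[OF that] by (auto dest: hconv_carrier)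
  have \<Phi>_add: "(x \<oplus>\<^bsub>K\<^esub> x', y \<oplus>\<^bsub>H\<^esub> y') \<in> \<Phi>" if xy: "(x, y) \<in> \<Phi>" "(x', y') \<in> \<Phi>" for x y x' y'
  proof -
    obtain u v u' v' where uv: "\<forall>n. (u n, v n) \<in> T" "hconv K u x" "hconv H v y"
      "\<forall>n. (u' n, v' n) \<in> T" "hconv K u' x'" "hconv H v' y'"
      using \<Phi>E[OF xy(1)] \<Phi>E[OF xy(2)] by blast
    show ?thesis
      by (rule \<Phi>I[of "\<lambda>n. (u n \<oplus>\<^bsub>K\<^esub> u' n, v n \<oplus>\<^bsub>H\<^esub> v' n)"])
        (use uv linear_operatorD(5)[OF T] K.hconv_add H.hconv_add in \<open>auto simp: o_def\<close>)
  qed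
  have \<Phi>_smult: "(c \<odot>\<^bsub>K\<^esub> x, c \<odot>\<^bsub>H\<^esub> y) \<in> \<Phi>" if xy: "(x, y) \<in> \<Phi>" for x y c
  proof -
    obtain u v where uv: "\<forall>n. (u n, v n) \<in> T" "hconv K u x" "hconv H v y"
      using \<Phi>E[OF xy] by blast
    show ?thesis
      by (rule \<Phi>I[of "\<lambda>n. (c \<odot>\<^bsub>K\<^esub> u n, c \<odot>\<^bsub>H\<^esub> v n)"])
        (use uv linear_operatorD(6)[OF T] K.hconv_smult H.hconv_smult in \<open>auto simp: o_def\<close>)
  qed
  have \<Phi>_eq: "y = y'" if xy: "(x, y) \<in> \<Phi>" "(x, y') \<in> \<Phi>" for x y y'
  proof -
    note c = \<Phi>_car[OF xy(1)] \<Phi>_car[OF xy(2)]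
    \<comment> \<open>All four inner products in the expansion equal \<langle>x, x\<rangle>, so they
      cancel.\<close>
    have "(hnorm H (y \<ominus>\<^bsub>H\<^esub> y'))\<^sup>2 = (hnorm K (x \<ominus>\<^bsub>K\<^esub> x))\<^sup>2"
      using c \<Phi>_cinner[OF xy] \<Phi>_cinner[OF xy(2) xy(1)]
        \<Phi>_cinner[OF xy(1) xy(1)] \<Phi>_cinner[OF xy(2) xy(2)]
      by (simp add: H.hnorm_power2 H.cinner_linear)
    then show ?thesis
      using c by (simp add: H.hnorm_eq_0_iff H.diff_eq_zero_iff)
  qed
  have lin: "linear_operator K H \<Phi>"
    unfolding linear_operator_def Ball_pair_iff single_valued_def
  proof (intro conjI allI impI)
    show "\<Phi> \<subseteq> carrier K \<times> carrier H"
      using \<Phi>_car by auto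
    show "(\<zero>\<^bsub>K\<^esub>, \<zero>\<^bsub>H\<^esub>) \<in> \<Phi>"
      by (rule subsetD[OF T_sub linear_operatorD(4)[OF T]])
  qed (fact \<Phi>_eq \<Phi>_add \<Phi>_smult)+
  have dom_\<Phi>: "Domain \<Phi> = carrier K"
  proof (intro equalityI subsetI)
    fix x
    assume "x \<in> carrier K"
    then obtain s y where "range s \<subseteq> T" "hconv K (fst \<circ> s) x" "hconv H (snd \<circ> s) y"
      using isometric_limit[OF H.complex_hilbert_space_axioms T iso dom] by blast
    then show "x \<in> Domain \<Phi>"
      using \<Phi>I by blast
  qed (use \<Phi>_car in blast)
  \<comment> \<open>Surjectivity is totality of the extension read backwards: the inverse graph of
    \<open>T\<close> is isometric with dense domain \<open>Range T\<close>, and its limits are the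
    wanted preimages.\<close>
  interpret HK: inner_space_pair H K ..
  have ran_\<Phi>: "Range \<Phi> = carrier H"
  proof (intro equalityI subsetI)
    fix y
    assume y: "y \<in> carrier H"
    obtain s x where s: "range s \<subseteq> T\<inverse>" "hconv H (fst \<circ> s) y" "hconv K (snd \<circ> s) x"
      using HK.isometric_limit[OF K.complex_hilbert_space_axioms
          linear_operator_converse[OF T isometric_converse_single_valued[OF T iso]] _ _ y] iso ran
      by (metis Domain_converse converseD)
    have "(snd (s n), fst (s n)) \<in> T" for n
      using s(1) by (metis converseD prod.collapse range_subsetD)
    then have "(x, y) \<in> \<Phi>"
      by (intro \<Phi>I[of "\<lambda>n. (snd (s n), fst (s n))"]) (use s(2,3) in \<open>auto simp: o_def\<close>)
    then show "y \<in> Range \<Phi>"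
      by blast
  qed (use \<Phi>_car in blast)
  have unitary: "unitary_operator K H \<Phi>"
    unfolding unitary_operator_def Ball_pair_iff using lin dom_\<Phi> ran_\<Phi> \<Phi>_cinner by blast
  show ?thesis
  proof (rule ex1I[of _ \<Phi>])
    show "unitary_operator K H \<Phi> \<and> T \<subseteq> \<Phi>"
      using unitary T_sub by blast
  next
    fix \<Psi>
    assume \<Psi>: "unitary_operator K H \<Psi> \<and> T \<subseteq> \<Psi>"
    then have lin': "linear_operator K H \<Psi>" and dom': "Domain \<Psi> = carrier K"
      and cinner': "\<And>x y x' y'. \<lbrakk>(x, y) \<in> \<Psi>; (x', y') \<in> \<Psi>\<rbrakk> \<Longrightarrow> \<langle>y, y'\<rangle>\<^bsub>H\<^esub> = \<langle>x, x'\<rangle>\<^bsub>K\<^esub>"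
      unfolding unitary_operator_def Ball_pair_iff by blast+
    have sub: "(x, y) \<in> \<Psi>" if xy: "(x, y) \<in> \<Phi>" for x y
    proof -
      obtain u v where uv: "\<forall>n. (u n, v n) \<in> T" "hconv K u x" "hconv H v y"
        using \<Phi>E[OF xy] by blast
      obtain y' where y': "(x, y') \<in> \<Psi>"
        using dom' \<Phi>_car[OF xy] by blast
      \<comment> \<open>A competing unitary operator preserves norms of differences, so its value at
        \<open>x\<close> is forced to be the limit of the values of \<open>T\<close> along
        \<open>u\<close>.\<close>
      have "hconv H v y'"
      proof (rule H.hconvI)
        show "hnorm H (v n \<ominus>\<^bsub>H\<^esub> y') \<le> hnorm K (u n \<ominus>\<^bsub>K\<^esub> x)" for n
        proof -
          have "(u n \<ominus>\<^bsub>K\<^esub> x, v n \<ominus>\<^bsub>H\<^esub> y') \<in> \<Psi>"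
            using linear_operator_diff[OF lin' _ y'] uv(1) \<Psi> by blast
          then show ?thesis
            using cinner' by (simp add: hnorm_def)
        qed
        show "(\<lambda>n. hnorm K (u n \<ominus>\<^bsub>K\<^esub> x)) \<longlonglongrightarrow> 0"
          using uv(2) by (simp add: hconv_def)
      qed (use hconv_carrier(1)[OF uv(3)] linear_operatorD(2)[OF lin' y'] in auto)
      then show ?thesis
        using y' uv(3) H.hconv_unique by blast
    qed
    show "\<Psi> = \<Phi>"
    proof (intro equalityI subrelI)
      fix x y
      assume xy: "(x, y) \<in> \<Psi>"
      then obtain y' where "(x, y') \<in> \<Phi>"
        using linear_operatorD(1)[OF lin'] dom_\<Phi> by blast
      then show "(x, y) \<in> \<Phi>"
        using sub xy linear_operatorD(3)[OF lin'] by metis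
    qed (rule sub)
  qed
qed

section \<open>The triplet generated by a closed embedding\<close>

locale dense_closed_embedding = hilbert_space_pair Hp H0
  for Hp :: "'p inner_space" and H0 :: "'z inner_space" +
  fixes jp :: "('p \<times> 'z) set"
  assumes embedding: "closed_embedding Hp H0 jp" and dense_Range: "dense_in H0 (Range jp)"
begin

section \<open>The adjoint of the inverse embedding\<close>

definition S :: "('p \<times> 'z) set" where
  "S = op_adjoint H0 Hp (jp\<inverse>)"

lemma linear_jp: "linear_operator Hp H0 jp" and dense_Domain: "dense_in Hp (Domain jp)"
  and jp_injective: "\<lbrakk>(x, w) \<in> jp; (x', w) \<in> jp\<rbrakk> \<Longrightarrow> x = x'"
  using embedding by (auto simp: closed_embedding_def closed_operator_def single_valued_def)

lemma mem_S_iff: "(z, y) \<in> S \<longleftrightarrow> z \<in> carrier Hp \<and> y \<in> carrier H0 \<and>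
    (\<forall>x w. (x, w) \<in> jp \<longrightarrow> \<langle>x, z\<rangle>\<^bsub>Hp\<^esub> = \<langle>w, y\<rangle>\<^bsub>H0\<^esub>)"
  by (auto simp: S_def op_adjoint_def)

lemma S_carrier: "(z, y) \<in> S \<Longrightarrow> z \<in> carrier Hp" "(z, y) \<in> S \<Longrightarrow> y \<in> carrier H0"
  by (auto simp: mem_S_iff)

lemma jp_carrier: "(x, w) \<in> jp \<Longrightarrow> x \<in> carrier Hp" "(x, w) \<in> jp \<Longrightarrow> w \<in> carrier H0"
  using linear_operatorD(1,2)[OF linear_jp] by blast+

text \<open>The defining identity of an adjoint only pairs the two components of a graph element, so
  inverting and taking adjoints commute.\<close>

lemma adjoint_eq: "op_adjoint Hp H0 jp = S\<inverse>"
  by (fastforce simp: mem_S_iff op_adjoint_def)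

text \<open>Two preimages of \<open>y\<close> have the same inner products with
  \<open>Domain jp\<close>, which is dense.\<close>

lemma S_injective:
  assumes "(z, y) \<in> S" "(z', y) \<in> S"
  shows "z = z'"
proof -
  note c = S_carrier[OF assms(1)] S_carrier[OF assms(2)]
  have "z \<ominus>\<^bsub>Hp\<^esub> z' = \<zero>\<^bsub>Hp\<^esub>"
    by (rule K.dense_in_orthogonal_eq_zero[OF dense_Domain])
      (use assms c jp_carrier in \<open>auto simp: mem_S_iff K.cinner_linear\<close>)
  then show ?thesis
    using c by (simp add: K.diff_eq_zero_iff)
qed

text \<open>Here density of \<open>Range jp\<close> enters: it makes the relation S the graph of an
  operator.\<close>

lemma S_single_valued:
  assumes "(z, y) \<in> S" "(z, y') \<in> S"
  shows "y = y'"
proof -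
  note c = S_carrier[OF assms(1)] S_carrier[OF assms(2)]
  have "y \<ominus>\<^bsub>H0\<^esub> y' = \<zero>\<^bsub>H0\<^esub>"
  proof (rule H.dense_in_orthogonal_eq_zero[OF dense_Range])
    fix w
    assume "w \<in> Range jp"
    then obtain x where xw: "(x, w) \<in> jp"
      by blast
    then have "\<langle>w, y\<rangle>\<^bsub>H0\<^esub> = \<langle>w, y'\<rangle>\<^bsub>H0\<^esub>"
      using assms by (metis mem_S_iff)
    then show "\<langle>w, y \<ominus>\<^bsub>H0\<^esub> y'\<rangle>\<^bsub>H0\<^esub> = 0"
      using c jp_carrier[OF xw] by (simp add: H.cinner_linear)
  qed (use c in simp)
  then show ?thesis
    using c by (simp add: H.diff_eq_zero_iff)
qed

lemma linear_S: "linear_operator Hp H0 S"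
  unfolding linear_operator_def Ball_pair_iff single_valued_def
proof (intro conjI allI impI)
  show "S \<subseteq> carrier Hp \<times> carrier H0"
    using S_carrier by auto
  show "y = y'" if "(z, y) \<in> S" "(z, y') \<in> S" for z y y'
    using that by (rule S_single_valued)
qed (use jp_carrier in \<open>auto simp: mem_S_iff K.cinner_linear H.cinner_linear\<close>)

lemma S_closed:
  assumes "\<And>n. (u n, v n) \<in> S" "hconv Hp u z" "hconv H0 v y"
  shows "(z, y) \<in> S"
  unfolding mem_S_iff
proof (intro conjI allI impI)
  fix x w
  assume xw: "(x, w) \<in> jp"
  have "(\<lambda>n. \<langle>x, u n\<rangle>\<^bsub>Hp\<^esub>) \<longlonglongrightarrow> \<langle>x, z\<rangle>\<^bsub>Hp\<^esub>"
    using jp_carrier[OF xw] assms(2) by (intro K.hconv_cinner K.hconv_const)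
  moreover have "(\<lambda>n. \<langle>w, v n\<rangle>\<^bsub>H0\<^esub>) \<longlonglongrightarrow> \<langle>w, y\<rangle>\<^bsub>H0\<^esub>"
    using jp_carrier[OF xw] assms(3) by (intro H.hconv_cinner H.hconv_const)
  moreover have "\<langle>x, u n\<rangle>\<^bsub>Hp\<^esub> = \<langle>w, v n\<rangle>\<^bsub>H0\<^esub>" for n
    using assms(1)[of n] xw by (simp add: mem_S_iff)
  ultimately show "\<langle>x, z\<rangle>\<^bsub>Hp\<^esub> = \<langle>w, y\<rangle>\<^bsub>H0\<^esub>"
    using LIMSEQ_unique by auto
qed (use assms(2,3) in \<open>auto dest: hconv_carrier\<close>)

text \<open>A vector orthogonal to the graph of \<open>jp\<close> is, up to a sign, an element of the graph of \<open>S\<close>;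
  hence the density of \<open>Ran S\<close> and of \<open>Dom S\<close> both come from separating a point
  from the closed graph of \<open>jp\<close>.\<close>

lemma S_separates:
  assumes ab: "a \<in> carrier Hp" "b \<in> carrier H0" "(a, b) \<notin> jp"
  shows "\<exists>z y. (z, y) \<in> S \<and> \<langle>a, z\<rangle>\<^bsub>Hp\<^esub> \<noteq> \<langle>b, y\<rangle>\<^bsub>H0\<^esub>"
proof -
  have closed: "\<forall>s a b. range s \<subseteq> jp \<longrightarrow> hconv Hp (fst \<circ> s) a \<longrightarrow> hconv H0 (snd \<circ> s) b \<longrightarrow> (a, b) \<in> jp"
    using embedding by (simp add: closed_embedding_def closed_operator_def closedin_prod_htop_iff)
  have sub: "jp \<subseteq> carrier Hp \<times> carrier H0"
    using linear_jp by (simp add: linear_operator_def)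
  obtain p where p: "p \<in> carrier (prod_space Hp H0)" "\<forall>q\<in>jp. \<langle>q, p\<rangle>\<^bsub>prod_space Hp H0\<^esub> = 0"
    "\<langle>(a, b), p\<rangle>\<^bsub>prod_space Hp H0\<^esub> \<noteq> 0"
  proof (rule P.closed_manifold_separation[OF linear_manifold_graph[OF linear_jp]])
    show "l \<in> jp" if "range s \<subseteq> jp" "hconv (prod_space Hp H0) s l" for s l
      using that closed sub hconv_prod_space[of s l] by (metis order_trans prod.collapse)
  qed (use ab in auto)
  obtain z q where zq: "p = (z, q)"
    by (rule prod.exhaust)
  have c: "z \<in> carrier Hp" "q \<in> carrier H0"
    using p(1) by (auto simp: zq)
  have "(z, (-1) \<odot>\<^bsub>H0\<^esub> q) \<in> S"
    unfolding mem_S_iff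
  proof (intro conjI allI impI)
    fix x w
    assume xw: "(x, w) \<in> jp"
    then have "\<langle>x, z\<rangle>\<^bsub>Hp\<^esub> + \<langle>w, q\<rangle>\<^bsub>H0\<^esub> = 0"
      using p(2) by (force simp: zq)
    then show "\<langle>x, z\<rangle>\<^bsub>Hp\<^esub> = \<langle>w, (-1) \<odot>\<^bsub>H0\<^esub> q\<rangle>\<^bsub>H0\<^esub>"
      using c jp_carrier[OF xw] by (simp add: H.cinner_linear eq_neg_iff_add_eq_0)
  qed (use c in auto)
  moreover have "\<langle>a, z\<rangle>\<^bsub>Hp\<^esub> \<noteq> \<langle>b, (-1) \<odot>\<^bsub>H0\<^esub> q\<rangle>\<^bsub>H0\<^esub>"
    using p(3) c ab by (simp add: zq H.cinner_linear eq_neg_iff_add_eq_0)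
  ultimately show ?thesis
    by blast
qed

text \<open>A vector \<open>u\<close> orthogonal to the range is a point \<open>(\<zero>, u)\<close>
  that no element of S separates from \<open>jp\<close>; it thus lies in \<open>jp\<close>, and
  single-valuedness of \<open>jp\<close> gives \<open>u = \<zero>\<close>.\<close>

lemma dense_Range_S: "dense_in H0 (Range S)"
proof (rule H.dense_inI_orthogonal[OF linear_manifold_Range[OF linear_S]])
  fix u
  assume u: "u \<in> carrier H0" and orth: "\<And>y. y \<in> Range S \<Longrightarrow> \<langle>y, u\<rangle>\<^bsub>H0\<^esub> = 0"
  have "\<langle>u, y\<rangle>\<^bsub>H0\<^esub> = \<langle>\<zero>\<^bsub>Hp\<^esub>, z\<rangle>\<^bsub>Hp\<^esub>" if "(z, y) \<in> S" for z y
    using orth[of y] that u S_carrier[OF that] H.cinner_commute[of u y] by auto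
  then have "(\<zero>\<^bsub>Hp\<^esub>, u) \<in> jp"
    using S_separates[of "\<zero>\<^bsub>Hp\<^esub>" u] u by fastforce
  then show "u = \<zero>\<^bsub>H0\<^esub>"
    using linear_operatorD(3,4)[OF linear_jp] by blast
qed

text \<open>The mirror image with the point \<open>(u, \<zero>)\<close>, where injectivity of
  \<open>jp\<close> concludes.\<close>

lemma dense_Domain_S: "dense_in Hp (Domain S)"
proof (rule K.dense_inI_orthogonal[OF linear_manifold_Domain[OF linear_S]])
  fix u
  assume u: "u \<in> carrier Hp" and orth: "\<And>z. z \<in> Domain S \<Longrightarrow> \<langle>z, u\<rangle>\<^bsub>Hp\<^esub> = 0"
  have "\<langle>u, z\<rangle>\<^bsub>Hp\<^esub> = \<langle>\<zero>\<^bsub>H0\<^esub>, y\<rangle>\<^bsub>H0\<^esub>" if "(z, y) \<in> S" for z y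
    using orth[of z] that u S_carrier[OF that] K.cinner_commute[of u z] by auto
  then have "(u, \<zero>\<^bsub>H0\<^esub>) \<in> jp"
    using S_separates[of u "\<zero>\<^bsub>H0\<^esub>"] u by fastforce
  then show "u = \<zero>\<^bsub>Hp\<^esub>"
    using jp_injective linear_operatorD(4)[OF linear_jp] by blast
qed

section \<open>The space \<R>(S) and the embedding into it\<close>

lemma reduced_preimage_eq:
  assumes "(z, y) \<in> S"
  shows "reduced_preimage Hp H0 S y = z"
  unfolding reduced_preimage_def
proof (rule the_equality)
  have "\<langle>z, x\<rangle>\<^bsub>Hp\<^esub> = 0" if "x \<in> null_space Hp H0 S" for x
  proof -
    have "x = \<zero>\<^bsub>Hp\<^esub>"
      using that S_injective linear_operatorD(4)[OF linear_S] by (auto simp: null_space_def)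
    then show ?thesis
      using S_carrier[OF assms] by simp
  qed
  then show "(z, y) \<in> S \<and> (\<forall>x\<in>null_space Hp H0 S. \<langle>z, x\<rangle>\<^bsub>Hp\<^esub> = 0)"
    using assms by blast
qed (use assms S_injective in blast)

lemma pre_R_space_simps [simp]:
  "carrier (pre_R_space Hp H0 S) = Range S"
  "\<zero>\<^bsub>pre_R_space Hp H0 S\<^esub> = \<zero>\<^bsub>H0\<^esub>"
  "u \<oplus>\<^bsub>pre_R_space Hp H0 S\<^esub> v = u \<oplus>\<^bsub>H0\<^esub> v"
  "c \<odot>\<^bsub>pre_R_space Hp H0 S\<^esub> u = c \<odot>\<^bsub>H0\<^esub> u"
  "\<langle>u, v\<rangle>\<^bsub>pre_R_space Hp H0 S\<^esub> = \<langle>reduced_preimage Hp H0 S u, reduced_preimage Hp H0 S v\<rangle>\<^bsub>Hp\<^esub>"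
  by (simp_all add: pre_R_space_def)

text \<open>The isometry is the inverse of S, from its range onto the dense set
  \<open>Domain S\<close> in \<open>Hp\<close>. From here on \<open>R.limit_class\<close> maps
  \<open>Hp\<close> isometrically onto \<R>(S).\<close>

sublocale R: dense_isometry "pre_R_space Hp H0 S" Hp "reduced_preimage Hp H0 S"
proof
  let ?V = "pre_R_space Hp H0 S" and ?\<psi> = "reduced_preimage Hp H0 S"
  show "?\<psi> y \<in> carrier Hp" if "y \<in> carrier ?V" for y
    using that S_carrier by (auto simp: reduced_preimage_eq)
  show "inj_on ?\<psi> (carrier ?V)"
    by (rule inj_onI) (auto simp: reduced_preimage_eq dest: S_single_valued)
  show "\<zero>\<^bsub>?V\<^esub> \<in> carrier ?V" "?\<psi> \<zero>\<^bsub>?V\<^esub> = \<zero>\<^bsub>Hp\<^esub>"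
    using linear_operatorD(4)[OF linear_S] by (auto simp: reduced_preimage_eq)
  show "u \<oplus>\<^bsub>?V\<^esub> v \<in> carrier ?V" "?\<psi> (u \<oplus>\<^bsub>?V\<^esub> v) = ?\<psi> u \<oplus>\<^bsub>Hp\<^esub> ?\<psi> v"
    if uv: "u \<in> carrier ?V" "v \<in> carrier ?V" for u v
  proof -
    obtain x y where xy: "(x, u) \<in> S" "(y, v) \<in> S"
      using uv by auto
    note xy_add = linear_operatorD(5)[OF linear_S xy]
    show "u \<oplus>\<^bsub>?V\<^esub> v \<in> carrier ?V" "?\<psi> (u \<oplus>\<^bsub>?V\<^esub> v) = ?\<psi> u \<oplus>\<^bsub>Hp\<^esub> ?\<psi> v"
      using xy xy_add by (auto simp: reduced_preimage_eq[OF xy_add] reduced_preimage_eq)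
  qed
  show "c \<odot>\<^bsub>?V\<^esub> u \<in> carrier ?V" "?\<psi> (c \<odot>\<^bsub>?V\<^esub> u) = c \<odot>\<^bsub>Hp\<^esub> ?\<psi> u"
    if u: "u \<in> carrier ?V" for c u
  proof -
    obtain x where x: "(x, u) \<in> S"
      using u by auto
    note x_smult = linear_operatorD(6)[OF linear_S x, of c]
    show "c \<odot>\<^bsub>?V\<^esub> u \<in> carrier ?V" "?\<psi> (c \<odot>\<^bsub>?V\<^esub> u) = c \<odot>\<^bsub>Hp\<^esub> ?\<psi> u"
      using x x_smult by (auto simp: reduced_preimage_eq[OF x_smult] reduced_preimage_eq)
  qed
  have "?\<psi> ` carrier ?V = Domain S"
    by (force simp: reduced_preimage_eq image_iff)
  then show "dense_in Hp (?\<psi> ` carrier ?V)"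
    using dense_Domain_S by simp
qed simp

definition jR :: "('z \<times> (nat \<Rightarrow> 'z) set) set" where
  "jR = (R_operator Hp H0 S)\<inverse>"

abbreviation R :: "(nat \<Rightarrow> 'z) set inner_space" where
  "R \<equiv> R_space Hp H0 S"

text \<open>Up to the isometry \<open>R.limit_class\<close>, the embedding \<open>jR\<close> is the
  inverse of S. Its linearity, injectivity, closedness and dense range are read off from S through
  this description.\<close>

lemma mem_jR_iff: "(y, r) \<in> jR \<longleftrightarrow> (\<exists>z. (z, y) \<in> S \<and> r = R.limit_class z)"
  using R.cauchy_class_const by (fastforce simp: jR_def R_operator_def reduced_preimage_eq)

lemma R_hilbert: "complex_hilbert_space R"
  unfolding R_space_def by (rule R.complex_hilbert_space_completion)

lemma R_carrier: "carrier R = R.limit_class ` carrier Hp"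
  by (simp add: R_space_def R.completion_carrier)

lemma hconv_R:
  "hconv R X Y \<longleftrightarrow> range X \<subseteq> carrier R \<and> Y \<in> carrier R \<and>
     hconv Hp (R.class_limit \<circ> X) (R.class_limit Y)"
  unfolding R_space_def by (rule R.hconv_completion)

lemma hnorm_jR:
  assumes "(y, r) \<in> jR" "(z, y) \<in> S"
  shows "hnorm R r = hnorm Hp z"
proof -
  have "r = R.limit_class z"
    using assms S_injective by (auto simp: mem_jR_iff)
  then show ?thesis
    using S_carrier[OF assms(2)] unfolding R_space_def
    by (simp add: hnorm_def R.completion_cinner)
qed

lemma Domain_jR: "Domain jR = Range S" and Range_jR: "Range jR = R.limit_class ` Domain S"
  by (auto simp: mem_jR_iff Domain_iff Range_iff image_iff) blast+

lemma linear_jR: "linear_operator H0 R jR"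
  unfolding linear_operator_def Ball_pair_iff single_valued_def
proof (intro conjI allI impI)
  show "jR \<subseteq> carrier H0 \<times> carrier R"
    using S_carrier by (auto simp: mem_jR_iff R_carrier)
  show "r = r'" if "(y, r) \<in> jR" "(y, r') \<in> jR" for y r r'
    using that S_injective by (auto simp: mem_jR_iff)
  show "(\<zero>\<^bsub>H0\<^esub>, \<zero>\<^bsub>R\<^esub>) \<in> jR"
    using linear_operatorD(4)[OF linear_S]
    by (auto simp: mem_jR_iff R_space_def R.completion_zero)
next
  fix y r y' r'
  assume "(y, r) \<in> jR" "(y', r') \<in> jR"
  then obtain z z' where z: "(z, y) \<in> S" "(z', y') \<in> S" "r = R.limit_class z" "r' = R.limit_class z'"
    by (auto simp: mem_jR_iff)
  then show "(y \<oplus>\<^bsub>H0\<^esub> y', r \<oplus>\<^bsub>R\<^esub> r') \<in> jR"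
    using linear_operatorD(5)[OF linear_S z(1,2)] S_carrier[OF z(1)] S_carrier[OF z(2)]
    by (auto simp: mem_jR_iff R_space_def R.completion_add)
next
  fix y r c
  assume "(y, r) \<in> jR"
  then obtain z where z: "(z, y) \<in> S" "r = R.limit_class z"
    by (auto simp: mem_jR_iff)
  then show "(c \<odot>\<^bsub>H0\<^esub> y, c \<odot>\<^bsub>R\<^esub> r) \<in> jR"
    using linear_operatorD(6)[OF linear_S z(1)] S_carrier[OF z(1)]
    by (auto simp: mem_jR_iff R_space_def R.completion_smult)
qed

lemma jR_injective: "single_valued (jR\<inverse>)"
proof (rule single_valuedI)
  fix r y y'
  assume "(r, y) \<in> jR\<inverse>" "(r, y') \<in> jR\<inverse>"
  then obtain z z' where z: "(z, y) \<in> S" "(z', y') \<in> S" "R.limit_class z = R.limit_class z'"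
    by (auto simp: mem_jR_iff)
  then have "z = z'"
    using R.inj_limit_class S_carrier(1) by (auto dest: inj_onD)
  then show "y = y'"
    using z S_single_valued by blast
qed

lemma dense_Range_jR: "dense_in R (Range jR)"
proof -
  interpret RR: complex_hilbert_space R
    by (rule R_hilbert)
  show ?thesis
    unfolding RR.dense_in_iff
  proof (intro conjI ballI)
    show "Range jR \<subseteq> carrier R"
      using linear_operatorD(2)[OF linear_jR] by blast
    fix X
    assume "X \<in> carrier R"
    then obtain h where h: "h \<in> carrier Hp" "X = R.limit_class h"
      by (auto simp: R_carrier)
    obtain u where u: "range u \<subseteq> Domain S" "hconv Hp u h"
      using dense_Domain_S h(1) K.dense_in_iff by blast
    have c: "u n \<in> carrier Hp" for n
      using u(2) by (rule hconv_carrier)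
    have "R.class_limit \<circ> (\<lambda>n. R.limit_class (u n)) = u"
      using c by (auto simp: R.class_limit_limit_class)
    then have "hconv R (\<lambda>n. R.limit_class (u n)) X"
      using c h u(2) by (auto simp: hconv_R R_carrier R.class_limit_limit_class)
    moreover have "range (\<lambda>n. R.limit_class (u n)) \<subseteq> Range jR"
      using u(1) unfolding Range_jR by blast
    ultimately show "\<exists>s. range s \<subseteq> Range jR \<and> hconv R s X"
      by blast
  qed
qed

lemma closed_embedding_jR: "closed_embedding H0 R jR"
proof -
  interpret HR: hilbert_space_pair H0 R
    using H.complex_hilbert_space_axioms R_hilbert by (rule hilbert_space_pair.intro)
  have "(a, X) \<in> jR"
    if s: "range s \<subseteq> jR" "hconv H0 (fst \<circ> s) a" "hconv R (snd \<circ> s) X" for s a X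
  proof -
    \<comment> \<open>In the coordinates \<open>R.class_limit\<close>, a sequence in the graph of
      \<open>jR\<close> becomes one in the graph of S with components exchanged, so
      \<open>S_closed\<close> applies.\<close>
    define u where "u n = R.class_limit (snd (s n))" for n
    have "(u n, fst (s n)) \<in> S" for n
    proof -
      have "(fst (s n), snd (s n)) \<in> jR"
        using s(1) by auto
      then obtain z where "(z, fst (s n)) \<in> S" "snd (s n) = R.limit_class z"
        unfolding mem_jR_iff by blast
      then show ?thesis
        using S_carrier(1) by (simp add: u_def R.class_limit_limit_class)
    qed
    moreover have "hconv Hp u (R.class_limit X)" and X: "X \<in> carrier R"
      using s(3) by (auto simp: hconv_R o_def u_def[abs_def])
    ultimately have "(R.class_limit X, a) \<in> S"
      using s(2) S_closed[of u "fst \<circ> s"] by simp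
    moreover have "X = R.limit_class (R.class_limit X)"
      using X R.limit_class_class_limit by (simp add: R_space_def)
    ultimately show ?thesis
      by (auto simp: mem_jR_iff)
  qed
  then have "closedin (prod_topology (htop H0) (htop R)) jR"
    using linear_jR by (auto simp: HR.closedin_prod_htop_iff linear_operator_def)
  then show ?thesis
    unfolding closed_embedding_def closed_operator_def
    using linear_jR jR_injective dense_Range_S by (simp add: Domain_jR)
qed

text \<open>For \<open>(x, w)\<close> in \<open>jp\<close>, membership in S says \<langle>w,
  y\<rangle> = \<langle>x, z\<rangle>, so the supremum in (th3) is the dual formula for
  \<parallel>z\<parallel> over the dense set \<open>Domain jp\<close>, reindexed by graph
  elements.\<close>

lemma hnorm_S_eq_SUP:
  assumes zy: "(z, y) \<in> S"
  shows "ennreal (hnorm Hp z) = (SUP (x, w) \<in> {(x, w) \<in> jp. x \<noteq> \<zero>\<^bsub>Hp\<^esub>}.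
    ennreal (cmod (\<langle>w, y\<rangle>\<^bsub>H0\<^esub>) / hnorm Hp x))"
proof -
  have "{x \<in> Domain jp. x \<noteq> \<zero>\<^bsub>Hp\<^esub>} = fst ` {(x, w) \<in> jp. x \<noteq> \<zero>\<^bsub>Hp\<^esub>}"
    by force
  then have "ennreal (hnorm Hp z) = (SUP p \<in> {(x, w) \<in> jp. x \<noteq> \<zero>\<^bsub>Hp\<^esub>}.
      ennreal (cmod (\<langle>fst p, z\<rangle>\<^bsub>Hp\<^esub>) / hnorm Hp (fst p)))"
    using K.hnorm_eq_SUP[OF dense_Domain S_carrier(1)[OF zy]] by (simp add: image_image)
  also have "\<dots> = (SUP (x, w) \<in> {(x, w) \<in> jp. x \<noteq> \<zero>\<^bsub>Hp\<^esub>}.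
      ennreal (cmod (\<langle>w, y\<rangle>\<^bsub>H0\<^esub>) / hnorm Hp x))"
    using zy by (intro SUP_cong) (auto simp: mem_S_iff)
  finally show ?thesis .
qed

lemma triplet_R: "triplet Hp H0 R jp jR"
  unfolding triplet_def Ball_pair_iff
proof (intro conjI allI impI)
  show "Domain (op_adjoint Hp H0 jp) \<subseteq> Domain jR"
    by (simp add: adjoint_eq Domain_jR)
  fix y r
  assume yr: "(y, r) \<in> jR"
  then obtain z where "(z, y) \<in> S"
    by (auto simp: mem_jR_iff)
  then show "ennreal (hnorm R r) = (SUP (x, w) \<in> {(x, w) \<in> jp. x \<noteq> \<zero>\<^bsub>Hp\<^esub>}.
      ennreal (cmod (\<langle>w, y\<rangle>\<^bsub>H0\<^esub>) / hnorm Hp x))"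
    using hnorm_S_eq_SUP hnorm_jR[OF yr] by simp
qed (fact K.complex_hilbert_space_axioms H.complex_hilbert_space_axioms R_hilbert embedding
    dense_Range closed_embedding_jR dense_Range_jR)+

text \<open>The norm condition of a triplet makes \<open>x \<mapsto> \<langle>j\<^sub>+ x, y\<rangle>\<close> bounded on \<open>Dom j\<^sub>+\<close>,
  so that the Riesz representation puts \<open>y\<close> into \<open>Dom j\<^sub>+\<^sup>* = Ran S\<close>.\<close>

lemma bounded_imp_Range_S:
  assumes y: "y \<in> carrier H0"
    and bound: "\<And>x w. (x, w) \<in> jp \<Longrightarrow> cmod \<langle>w, y\<rangle>\<^bsub>H0\<^esub> \<le> C * hnorm Hp x"
  shows "y \<in> Range S"
proof -
  \<comment> \<open>The functional x \<mapsto> \<langle>jp x, y\<rangle>; \<open>jp\<close> is a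
    graph, so its value is extracted by a definite description, meaningful on
    \<open>Domain jp\<close> only.\<close>
  define f where "f x = \<langle>THE w. (x, w) \<in> jp, y\<rangle>\<^bsub>H0\<^esub>" for x
  have f: "f x = \<langle>w, y\<rangle>\<^bsub>H0\<^esub>" if "(x, w) \<in> jp" for x w
  proof -
    have "(THE w. (x, w) \<in> jp) = w"
      using that linear_operatorD(3)[OF linear_jp] by blast
    then show ?thesis
      by (simp add: f_def)
  qed
  obtain z s where z: "hconv Hp s z" "\<forall>x\<in>Domain jp. f x = \<langle>x, z\<rangle>\<^bsub>Hp\<^esub>"
  proof (rule K.Riesz_linear_manifold[OF linear_manifold_Domain[OF linear_jp], of f C])
    fix x x'
    assume "x \<in> Domain jp" "x' \<in> Domain jp"
    then obtain w w' where w: "(x, w) \<in> jp" "(x', w') \<in> jp"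
      by blast
    then show "f (x \<oplus>\<^bsub>Hp\<^esub> x') = f x + f x'"
      using f[OF w(1)] f[OF w(2)] f[OF linear_operatorD(5)[OF linear_jp w]]
        jp_carrier[OF w(1)] jp_carrier[OF w(2)] y by (simp add: H.cinner_linear)
  next
    fix c x
    assume "x \<in> Domain jp"
    then obtain w where w: "(x, w) \<in> jp"
      by blast
    then show "f (c \<odot>\<^bsub>Hp\<^esub> x) = c * f x"
      using f[OF w] f[OF linear_operatorD(6)[OF linear_jp w]] jp_carrier[OF w] y
      by (simp add: H.cinner_linear)
  next
    show "cmod (f x) \<le> C * hnorm Hp x" if "x \<in> Domain jp" for x
      using that f bound by auto
  qed
  have "(z, y) \<in> S"
    unfolding mem_S_iff using y z f hconv_carrier(2)[OF z(1)] by (metis DomainI)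
  then show ?thesis
    by blast
qed

section \<open>Comparison with an arbitrary triplet\<close>

context
  fixes Hm :: "'m inner_space" and jm :: "('z \<times> 'm) set"
  assumes triplet_Hm: "triplet Hp H0 Hm jp jm"
begin

lemma Hm_hilbert: "complex_hilbert_space Hm"
  and linear_jm: "linear_operator H0 Hm jm" and jm_injective: "single_valued (jm\<inverse>)"
  and dense_Range_jm: "dense_in Hm (Range jm)"
  and Range_S_subset: "Range S \<subseteq> Domain jm"
  and hnorm_jm: "(y, v) \<in> jm \<Longrightarrow> ennreal (hnorm Hm v) =
        (SUP (x, w) \<in> {(x, w) \<in> jp. x \<noteq> \<zero>\<^bsub>Hp\<^esub>}. ennreal (cmod (\<langle>w, y\<rangle>\<^bsub>H0\<^esub>) / hnorm Hp x))"
  using triplet_Hm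
  unfolding triplet_def Ball_pair_iff closed_embedding_def closed_operator_def adjoint_eq
  by simp_all

text \<open>The supremum in (th3) equals the finite number \<parallel>v\<parallel>, which is the
  bound required by \<open>bounded_imp_Range_S\<close>; the other inclusion is the domain condition
  of (th3).\<close>

lemma Domain_jm: "Domain jm = Range S"
proof (intro equalityI subsetI)
  fix y
  assume "y \<in> Domain jm"
  then obtain v where yv: "(y, v) \<in> jm"
    by blast
  interpret Hm: complex_hilbert_space Hm
    by (rule Hm_hilbert)
  have v: "0 \<le> hnorm Hm v"
    using linear_operatorD(2)[OF linear_jm yv] by simp
  show "y \<in> Range S"
  proof (rule bounded_imp_Range_S)
    show "y \<in> carrier H0"
      using linear_operatorD(1)[OF linear_jm yv] .
    show "cmod \<langle>w, y\<rangle>\<^bsub>H0\<^esub> \<le> hnorm Hm v * hnorm Hp x" if xw: "(x, w) \<in> jp" for x w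
    \<comment> \<open>The supremum omits x = 0; there the bound holds because \<open>jp\<close> maps
      zero to zero.\<close>
    proof (cases "x = \<zero>\<^bsub>Hp\<^esub>")
      case True
      then have "w = \<zero>\<^bsub>H0\<^esub>"
        using xw linear_operatorD(3,4)[OF linear_jp] by blast
      then show ?thesis
        using True linear_operatorD(1)[OF linear_jm yv] by simp
    next
      case False
      then have pos: "0 < hnorm Hp x"
        using K.hnorm_eq_0_iff K.hnorm_nonneg jp_carrier(1)[OF xw] by (simp add: less_le)
      have "ennreal (cmod \<langle>w, y\<rangle>\<^bsub>H0\<^esub> / hnorm Hp x) \<le> ennreal (hnorm Hm v)"
        unfolding hnorm_jm[OF yv] using xw False by (intro SUP_upper2[of "(x, w)"]) auto
      then show ?thesis
        using v pos by (simp add: pos_divide_le_eq)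
    qed
  qed
qed (use Range_S_subset in blast)

lemma ex1_unitary_identity_on_jm:
  "\<exists>!\<Phi>. unitary_operator Hm R \<Phi> \<and> (\<forall>(y, v) \<in> jm. \<exists>r. (y, r) \<in> jR \<and> (v, r) \<in> \<Phi>)"
proof -
  interpret MR: hilbert_space_pair Hm R
    using Hm_hilbert R_hilbert by (rule hilbert_space_pair.intro)
  \<comment> \<open>The identity on the common domain of \<open>jm\<close> and \<open>jR\<close>:
    \<open>v\<close> and \<open>r\<close> are related when both are images of one vector
    \<open>y\<close> of \<open>H0\<close>.\<close>
  define T where "T = jm\<inverse> O jR"
  have dom_eq: "Domain jm = Domain jR"
    by (simp add: Domain_jm Domain_jR)
  have "\<exists>!\<Phi>. unitary_operator Hm R \<Phi> \<and> T \<subseteq> \<Phi>"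
  proof (rule MR.ex1_unitary_extension)
    show "linear_operator Hm R T"
      unfolding T_def
      by (rule linear_operator_relcomp[OF linear_operator_converse[OF linear_jm jm_injective] linear_jR])
    show "hnorm R r = hnorm Hm v" if vr: "(v, r) \<in> T" for v r
    proof -
      obtain y where yz: "(y, v) \<in> jm" "(y, r) \<in> jR"
        using vr by (auto simp: T_def)
      moreover obtain z where "(z, y) \<in> S"
        using yz(2) by (auto simp: mem_jR_iff)
      \<comment> \<open>Both norms of \<open>y\<close> are values of the same supremum, which
        mentions only \<open>jp\<close> and \<open>y\<close>.\<close>
      ultimately have "ennreal (hnorm R r) = ennreal (hnorm Hm v)"
        using hnorm_jm hnorm_S_eq_SUP hnorm_jR by simp
      then show ?thesis
        using linear_operatorD(2)[OF linear_jm yz(1)] linear_operatorD(2)[OF linear_jR yz(2)] by simp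
    qed
    have "Domain T = Range jm" "Range T = Range jR"
      using dom_eq unfolding T_def by blast+
    then show "dense_in Hm (Domain T)" "dense_in R (Range T)"
      using dense_Range_jm dense_Range_jR by simp_all
  qed
  \<comment> \<open>Extending \<open>T\<close> and acting as the identity coincide: one direction
    needs every \<open>y\<close> in \<open>Domain jm\<close> to have an image under
    \<open>jR\<close>, the other that this image is unique.\<close>
  moreover have "T \<subseteq> \<Phi> \<longleftrightarrow> (\<forall>(y, v) \<in> jm. \<exists>r. (y, r) \<in> jR \<and> (v, r) \<in> \<Phi>)" for \<Phi>
  proof
    show "\<forall>(y, v) \<in> jm. \<exists>r. (y, r) \<in> jR \<and> (v, r) \<in> \<Phi>" if "T \<subseteq> \<Phi>"
      using that dom_eq unfolding T_def by blast
    show "T \<subseteq> \<Phi>" if "\<forall>(y, v) \<in> jm. \<exists>r. (y, r) \<in> jR \<and> (v, r) \<in> \<Phi>"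
      using that linear_operatorD(3)[OF linear_jR] unfolding T_def by blast
  qed
  ultimately show ?thesis
    by simp
qed

end

end

theorem theorem5p2:
  fixes Hp :: "'p inner_space" and H0 :: "'z inner_space" and jp :: "('p \<times> 'z) set"
  assumes "complex_hilbert_space H0" and "complex_hilbert_space Hp"
    and "closed_embedding Hp H0 jp" and "dense_in H0 (Range jp)"
  shows "let S = op_adjoint H0 Hp (jp\<inverse>); jS = R_operator Hp H0 S in
    triplet Hp H0 (R_space Hp H0 S) jp (jS\<inverse>) \<and>
    (\<forall>(Hm :: 'm inner_space) jm A.
       triplet Hp H0 Hm jp jm \<and> A = kernel_operator Hp H0 jp \<longrightarrow>
       (\<exists>!\<Phi>. unitary_operator Hm (R_space Hp H0 S) \<Phi> \<and>
          (\<forall>(y, v) \<in> jm. \<exists>r. (y, r) \<in> jS\<inverse> \<and> (v, r) \<in> \<Phi>)))"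
proof -
  interpret dense_closed_embedding Hp H0 jp
    using assms by (simp add: dense_closed_embedding_def dense_closed_embedding_axioms_def
        hilbert_space_pair_def)
  show ?thesis
    unfolding Let_def
  proof (intro conjI allI impI)
    show "triplet Hp H0 (R_space Hp H0 (op_adjoint H0 Hp (jp\<inverse>))) jp
        ((R_operator Hp H0 (op_adjoint H0 Hp (jp\<inverse>)))\<inverse>)"
      by (fact triplet_R[unfolded jR_def S_def])
  next
    fix Hm :: "'m inner_space" and jm A
    assume "triplet Hp H0 Hm jp jm \<and> A = kernel_operator Hp H0 jp"
    then show "\<exists>!\<Phi>. unitary_operator Hm (R_space Hp H0 (op_adjoint H0 Hp (jp\<inverse>))) \<Phi> \<and>
        (\<forall>(y, v) \<in> jm. \<exists>r. (y, r) \<in> (R_operator Hp H0 (op_adjoint H0 Hp (jp\<inverse>)))\<inverse> \<and> (v, r) \<in> \<Phi>)"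
      by (intro ex1_unitary_identity_on_jm[unfolded jR_def S_def]) (rule conjunct1)
  qed
qed

end
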